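(* Let $(P,\ell,\mathcal F)$ be a learning problem with optimal $f^*$ and let $\Pi_|$ be an arbitrary learning algorithm for it. Assume that $(P,\ell,\mathcal F)$ satisfies the $(u,c)$-witness condition for some $u>0$, $c\in(0,1]$. Then under the $v$-PPC condition, for any $\epsilon\ge0$, any $0<\eta<\frac{v(\epsilon)}2$ and every $n\ge1$, $$\mathbf E_{Z^n}\Big[\mathbf E_{f\sim\Pi_n}\big[\mathbf E[L_f]\big]\Big]\ \le\ c'_{2u}\Big(\mathbf E_{Z^n}\big[\mathrm{IC}_{n,\eta}(\Pi_|)\big]+\epsilon\Big),\qquad c'_{2u}:=\frac1c\,\frac{2\eta u+1}{1-\frac{2\eta}{v(\epsilon)}}.$$
   Context: Learning problem $(P,\ell,\mathcal F)$: $P$ is a probability distribution on a measurable sample space $\mathcal Z$; $\mathcal F$ is a set (the model); $\ell:\mathcal F\times\mathcal Z\to\mathbb R\cup\{\infty\}$ is a loss, $\ell_f(z):=\ell(f,z)$; $\ell_f$ also denotes the random variable $\ell_f(Z)$ with $Z\sim P$; $\mathbf E$ is expectation under $P$. Standing assumptions: (1) unless $\ell$ is (conditional) log loss, $\inf_{f\in\mathcal F}\inf_{z\in\mathcal Z}\ell_f(z)>-\infty$; (2) if $\ell$ is (conditional) log loss $\ell_f=-\log p_f$, all $p_f$ are probability densities relative to a common dominating measure $\mu$, $P\ll\mu$, $\mathrm{KL}(P\|P_{f^*})<\infty$ and the differential entropy of $P$ relative to $\mu$ is $>-\infty$; (3) $\mathbf E[\ell_f]<\infty$ for some $f\in\mathcal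 F$; (4) there is an optimal $f^*\in\mathcal F$, i.e. $\mathbf E[\ell_f-\ell_{f^*}]\ge 0$ for all $f\in\mathcal F$; one such $f^*$ is fixed. Excess loss: $L_f:=\ell_f-\ell_{f^*}$. Learning algorithm $\Pi_|$: a function mapping each sample $z^n\in\mathcal Z^n$, $n=0,1,2,\dots$, to a probability distribution on $\mathcal F$. $\Pi_n$ denotes the output on $Z^n=(Z_1,\dots,Z_n)$, with $Z_1,\dots,Z_n$ i.i.d. $\sim P$; $\Pi_0$ (output on the empty sample) is called the prior. It is assumed that $\Pi_n$ always has a density relative to $\Pi_0$ and that $\Pi_0(\{f:\ell_f(z)<\infty\})>0$ for all $z\in\mathcal Z$. In $\mathbf E_{f\sim\Pi_n}[\mathbf E[L_f]]$ the inner expectation is over a fresh $Z\sim P$ independent of $Z^n$. Information complexity (a random variable depending on $Z^n$): $\mathrm{IC}_{n,\eta}(\Pi_|):=\mathbf E_{f\sim\Pi_n}\big[\frac1n\sum_{i=1}^n L_f(Z_i)\big]+\frac{\mathrm{KL}(\Pi_n\|\Pi_0)}{\eta n}$. $(u,c)$-witness condition: for all $f\in\mathcal F$, $\mathbf E[L_f\cdot\mathbf 1_{\{L_f\le u\}}]\ge c\,\mathbf E[L_f]$. $v$-PPC (pseudoprobability convexity) condition: $v:[0,\infty)\to[0,\infty)$ is a bounded non-decreasing function with $v(\epsilon)>0$ for all $\epsilon>0$, and for every $\epsilon\ge0$, with $\eta=v(\epsilon)$ (the requirement being void if $v(\epsilon)=0$), there is $\tilde f\in\mathcal F$ with $$\mathbf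 E[\ell_{\tilde f}]-\inf_{Q\in\Delta(\mathcal F)}\mathbf E_{Z\sim P}\Big[-\tfrac1{\eta}\log\mathbf E_{f\sim Q}\big[e^{-\eta\ell_f(Z)}\big]\Big]\le\epsilon,$$ where $\Delta(\mathcal F)$ is the set of probability distributions on $\mathcal F$. (Equivalently, this holds with $\tilde f=f^*$.) The infimum is achieved in the limit by a "generalized reversed information projection": there is a measurable function $m^{\eta}_{\mathcal F}:\mathcal Z\to\mathbb R$ whose $P$-expectation equals the infimum and which is the $L_1(P)$-limit of functions $-\frac1\eta\log\mathbf E_{f\sim Q_k}[e^{-\eta\ell_f}]$ for some sequence $Q_k\in\Delta(\mathcal F)$. *)

theory Defs
  imports "HOL-Probability.Probability"
begin

text \<open>Positive part minus negative part. When both parts are infinite the value is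
  \<open>\<infinity> - \<infinity> = \<infinity>\<close>; \<open>expectation_defined\<close> excludes this case.\<close>

definition ereal_expectation :: "'a measure \<Rightarrow> ('a \<Rightarrow> ereal) \<Rightarrow> ereal" where
  "ereal_expectation M X =
     enn2ereal (\<integral>\<^sup>+ x. e2ennreal (X x) \<partial>M) - enn2ereal (\<integral>\<^sup>+ x. e2ennreal (- X x) \<partial>M)"

definition expectation_defined :: "'a measure \<Rightarrow> ('a \<Rightarrow> ereal) \<Rightarrow> bool" where
  "expectation_defined M X \<longleftrightarrow>
     (\<integral>\<^sup>+ x. e2ennreal (X x) \<partial>M) < \<infinity> \<or> (\<integral>\<^sup>+ x. e2ennreal (- X x) \<partial>M) < \<infinity>"

definition exp_ereal :: "ereal \<Rightarrow> ennreal" where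
  "exp_ereal x = (if x = \<infinity> then \<infinity> else if x = -\<infinity> then 0 else ennreal (exp (real_of_ereal x)))"

definition ln_ennreal :: "ennreal \<Rightarrow> ereal" where
  "ln_ennreal x = (if x = 0 then -\<infinity> else if x = \<infinity> then \<infinity> else ereal (ln (enn2real x)))"

text \<open>The library's \<^const>\<open>KL_divergence\<close> takes the reference measure first and is a real
  Bochner integral. For probability measures the negative part of the log density ratio is always
  integrable, so failure of integrability means that the divergence is infinite.\<close>

definition KL :: "'a measure \<Rightarrow> 'a measure \<Rightarrow> ereal" where
  "KL Q R =
     (if absolutely_continuous R Q \<and> integrable Q (entropy_density (exp 1) R Q)
      then ereal (KL_divergence (exp 1) R Q) else \<infinity>)"

text \<open>The model is \<open>space F\<close>; the measure carried by \<open>F\<close> is irrelevant, only its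
  \<open>\<sigma>\<close>-algebra matters (for distributions on the model).\<close>

definition excess_loss :: "('f \<Rightarrow> 'z \<Rightarrow> ereal) \<Rightarrow> 'f \<Rightarrow> 'f \<Rightarrow> 'z \<Rightarrow> ereal" where
  "excess_loss l fs f z = l f z - l fs z"

text \<open>Conditional log loss on \<open>X \<times> Y\<close>, with conditional densities \<open>p\<^sub>f(y | x)\<close> relative to
  \<open>\<nu>\<close>, is the instance where \<open>\<mu>\<close> is the product of the \<open>X\<close>-marginal of \<open>P\<close> and \<open>\<nu>\<close>.
  The last two conjuncts say that the differential entropy
  \<open>E[- log (dP/d\<mu>)]\<close> is well defined and not \<open>-\<infinity>\<close>.\<close>

definition regular_log_loss ::
    "'z measure \<Rightarrow> 'f measure \<Rightarrow> ('f \<Rightarrow> 'z \<Rightarrow> ereal) \<Rightarrow> 'f \<Rightarrow> bool" where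
  "regular_log_loss P F l fs \<longleftrightarrow>
     (\<exists>\<mu> (p :: 'f \<Rightarrow> 'z \<Rightarrow> real).
        sigma_finite_measure \<mu> \<and> sets \<mu> = sets P \<and>
        (\<forall>f\<in>space F. p f \<in> borel_measurable \<mu> \<and> prob_space (density \<mu> (\<lambda>z. ennreal (p f z))) \<and>
           (\<forall>z\<in>space P. 0 \<le> p f z \<and> l f z = - ln_ennreal (ennreal (p f z)))) \<and>
        absolutely_continuous \<mu> P \<and>
        KL P (density \<mu> (\<lambda>z. ennreal (p fs z))) < \<infinity> \<and>
        expectation_defined P (\<lambda>z. ereal (- entropy_density (exp 1) \<mu> P z)) \<and>
        -\<infinity> < ereal_expectation P (\<lambda>z. ereal (- entropy_density (exp 1) \<mu> P z)))"

definition learning_problem ::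
    "'z measure \<Rightarrow> 'f measure \<Rightarrow> ('f \<Rightarrow> 'z \<Rightarrow> ereal) \<Rightarrow> 'f \<Rightarrow> bool" where
  "learning_problem P F l fs \<longleftrightarrow>
     prob_space P \<and>
     (\<lambda>(f, z). l f z) \<in> borel_measurable (F \<Otimes>\<^sub>M P) \<and>
     (\<forall>f\<in>space F. \<forall>z\<in>space P. l f z \<noteq> -\<infinity>) \<and>
     (-\<infinity> < (INF f\<in>space F. INF z\<in>space P. l f z) \<or> regular_log_loss P F l fs) \<and>
     (\<exists>f\<in>space F. ereal_expectation P (l f) < \<infinity>) \<and>
     fs \<in> space F \<and>
     (\<forall>f\<in>space F. 0 \<le> ereal_expectation P (excess_loss l fs f))"

definition witness_condition ::
    "'z measure \<Rightarrow> 'f measure \<Rightarrow> ('f \<Rightarrow> 'z \<Rightarrow> ereal) \<Rightarrow> 'f \<Rightarrow> real \<Rightarrow> real \<Rightarrow> bool" where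
  "witness_condition P F l fs u c \<longleftrightarrow>
     (\<forall>f\<in>space F.
        ereal_expectation P
          (\<lambda>z. excess_loss l fs f z * indicator {z. excess_loss l fs f z \<le> ereal u} z)
        \<ge> ereal c * ereal_expectation P (excess_loss l fs f))"

definition mix_loss :: "('f \<Rightarrow> 'z \<Rightarrow> ereal) \<Rightarrow> real \<Rightarrow> 'f measure \<Rightarrow> 'z \<Rightarrow> ereal" where
  "mix_loss l \<eta> Q z =
     ereal (- (1 / \<eta>)) * ln_ennreal (\<integral>\<^sup>+ f. exp_ereal (ereal (- \<eta>) * l f z) \<partial>Q)"

text \<open>The points of \<open>prob_algebra F\<close> are exactly the probability distributions on the model.\<close>

definition PPC_condition ::
    "'z measure \<Rightarrow> 'f measure \<Rightarrow> ('f \<Rightarrow> 'z \<Rightarrow> ereal) \<Rightarrow> (real \<Rightarrow> real) \<Rightarrow> bool" where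
  "PPC_condition P F l v \<longleftrightarrow>
     (\<forall>\<epsilon>\<ge>0. 0 \<le> v \<epsilon>) \<and> bounded (v ` {0..}) \<and> mono_on {0..} v \<and> (\<forall>\<epsilon>>0. 0 < v \<epsilon>) \<and>
     (\<forall>\<epsilon>\<ge>0. 0 < v \<epsilon> \<longrightarrow>
        (\<exists>f'\<in>space F.
           ereal_expectation P (l f')
           - (INF Q\<in>space (prob_algebra F). ereal_expectation P (mix_loss l (v \<epsilon>) Q))
           \<le> ereal \<epsilon>))"

text \<open>A sample \<open>z\<^sub>1, \<dots>, z\<^sub>n\<close> is a list, so \<open>A []\<close> is the prior. The first conjunct makes
  \<open>A\<close>, on samples of each size, a probability kernel into the model.\<close>

definition learning_algorithm ::
    "'z measure \<Rightarrow> 'f measure \<Rightarrow> ('f \<Rightarrow> 'z \<Rightarrow> ereal) \<Rightarrow> ('z list \<Rightarrow> 'f measure) \<Rightarrow> bool" where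
  "learning_algorithm P F l A \<longleftrightarrow>
     (\<forall>n. (\<lambda>\<omega>. A (map \<omega> [0..<n])) \<in> PiM {..<n} (\<lambda>_. P) \<rightarrow>\<^sub>M prob_algebra F) \<and>
     (\<forall>zs\<in>lists (space P). \<exists>w\<in>borel_measurable (A []). A zs = density (A []) w) \<and>
     (\<forall>z\<in>space P. 0 < emeasure (A []) {f \<in> space F. l f z < \<infinity>})"

text \<open>If the divergence is infinite, the information complexity is \<open>\<infinity>\<close>, even when the empirical
  term is \<open>-\<infinity>\<close>.\<close>

definition information_complexity ::
    "('f \<Rightarrow> 'z \<Rightarrow> ereal) \<Rightarrow> 'f \<Rightarrow> ('z list \<Rightarrow> 'f measure) \<Rightarrow> real \<Rightarrow> 'z list \<Rightarrow> ereal" where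
  "information_complexity l fs A \<eta> zs =
     ereal_expectation (A zs)
       (\<lambda>f. ereal (1 / real (length zs)) * (\<Sum>z\<leftarrow>zs. excess_loss l fs f z))
     + KL (A zs) (A []) / ereal (\<eta> * real (length zs))"

definition sample_expectation :: "'z measure \<Rightarrow> nat \<Rightarrow> ('z list \<Rightarrow> ereal) \<Rightarrow> ereal" where
  "sample_expectation P n X =
     ereal_expectation (PiM {..<n} (\<lambda>_. P)) (\<lambda>\<omega>. X (map \<omega> [0..<n]))"

end

theory Submission
  imports Defs "HOL-Real_Asymp.Real_Asymp"
begin

text \<open>Write \<open>k = v(\<epsilon>)\<close> and let \<open>m\<close> be the reversed information projection at level \<open>k\<close>,
  so that \<open>E[exp (- k (l\<^sub>f - m))] \<le> 1\<close> for every \<open>f\<close> and \<open>E[l\<^sub>f\<^sub>* - m] \<le> \<epsilon>\<close>. It is the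
  \<open>L\<^sub>1\<close>-limit of almost optimal mixture losses: mixing two of them with weight \<open>1/2\<close> gains
  \<open>ln cosh\<close> of half their difference, which makes any minimizing sequence Cauchy.

  With \<open>X = l\<^sub>f - m\<close> and \<open>Y = l\<^sub>f\<^sub>* - m\<close>, an elementary inequality bounds the truncated excess
  loss \<open>(X - Y) 1{X - Y \<le> u}\<close> by a multiple of \<open>(1 - exp (- \<eta> X)) / \<eta>\<close> plus terms of
  nonpositive expectation; by the witness condition the risk of \<open>f\<close> is bounded by
  \<open>E[1 - exp (- \<eta> X)] / \<eta>\<close>. The latter is controlled by PAC-Bayes (a change of measure from the
  posterior to the prior) applied to the losses \<open>l\<^sub>f - m\<close>; replacing \<open>m\<close> by \<open>l\<^sub>f\<^sub>*\<close> in the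
  empirical term costs \<open>\<epsilon>\<close> in expectation. This gives the constant with \<open>\<eta>\<close> in place of
  \<open>2 \<eta>\<close>, which is smaller.\<close>

subsection \<open>An elementary inequality\<close>

lemma exp_weighted_mean:
  fixes a x :: real
  assumes "0 \<le> a" "a \<le> 1"
  shows "exp (- a * x) \<le> a * exp (- x) + (1 - a)"
proof -
  have "exp ((1 - a) *\<^sub>R 0 + a *\<^sub>R (- x)) \<le> (1 - a) * exp 0 + a * exp (- x)"
    by (rule convex_onD[OF exp_convex]) (use assms in auto)
  then show ?thesis by simp
qed

text \<open>Normalized to \<open>k = 1\<close>: \<open>x - 1 + exp (- x)\<close> is the amount by
  which x exceeds \<open>hellinger 1 x\<close>, and the right side is the gap between the transforms
  of order a and order 1. The difference of the two sides vanishes at 0 and is nonincreasing by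
  \<open>exp_weighted_mean\<close>.\<close>

lemma hellinger_gap_neg:
  fixes a x :: real
  assumes a: "0 < a" "a < 1" and x: "x \<le> 0"
  shows "(1 - a) * (x - 1 + exp (- x)) \<le> (1 - exp (- a * x)) / a - (1 - exp (- x))"
proof -
  let ?W = "\<lambda>x. (1 - exp (- a * x)) / a - (1 - exp (- x)) - (1 - a) * (x - 1 + exp (- x))"
  have "?W 0 \<le> ?W x"
  proof (rule DERIV_nonpos_imp_nonincreasing[OF x])
    fix t :: real
    have "DERIV ?W t :> exp (- a * t) - exp (- t) - (1 - a) * (1 - exp (- t))"
      using a by (auto intro!: derivative_eq_intros)
    moreover have "exp (- a * t) - exp (- t) - (1 - a) * (1 - exp (- t)) \<le> 0"
      using exp_weighted_mean[of a t] a by (simp add: algebra_simps)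
    ultimately show "\<exists>y. DERIV ?W t :> y \<and> y \<le> 0" by blast
  qed
  then show ?thesis by simp
qed

lemma hellinger_gap_pos:
  fixes a x :: real
  assumes a: "0 < a" "a < 1" and x: "0 \<le> x"
  shows "(1 - a) * (x - 1 + exp (- x)) \<le> (1 + a * x) * ((1 - exp (- a * x)) / a - (1 - exp (- x)))"
proof -
  \<comment> \<open>This is \<open>a\<close> times the difference of the two sides; the factor
    clears \<open>1 / a\<close> and leaves a derivative whose sign is visible.\<close>
  let ?W = "\<lambda>x. 1 - (1 + a * x) * exp (- a * x) - a\<^sup>2 * (1 - (1 + x) * exp (- x))"
  have "?W 0 \<le> ?W x"
  proof (rule DERIV_nonneg_imp_nondecreasing[OF x])
    fix t :: real assume t: "0 \<le> t"
    have "DERIV ?W t :> a\<^sup>2 * t * (exp (- a * t) - exp (- t))"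
      by (auto intro!: derivative_eq_intros simp: algebra_simps power2_eq_square)
    moreover have "a * t \<le> t" using a t by (simp add: mult_left_le_one_le)
    then have "0 \<le> a\<^sup>2 * t * (exp (- a * t) - exp (- t))"
      using t by simp
    ultimately show "\<exists>y. DERIV ?W t :> y \<and> 0 \<le> y" by blast
  qed
  moreover have "?W x = a * ((1 + a * x) * ((1 - exp (- a * x)) / a - (1 - exp (- x)))
      - (1 - a) * (x - 1 + exp (- x)))"
    using a by (simp add: field_simps power2_eq_square)
  ultimately have "0 \<le> a * ((1 + a * x) * ((1 - exp (- a * x)) / a - (1 - exp (- x)))
      - (1 - a) * (x - 1 + exp (- x)))" by simp
  then show ?thesis using a by (simp only: zero_le_mult_iff) linarith
qed

text \<open>For \<open>r x = x - 1 + exp (- x)\<close>, the factor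
  \<open>u - exp (- x) * (exp u - 1)\<close> is \<open>r x - r (x - u)\<close>, the largest value of
  \<open>r x - r y\<close> over y \<ge> x - u when x \<ge> u. The difference \<open>G\<close> of the
  two sides has a single critical point, which splits the argument.\<close>

lemma hellinger_gap_large:
  fixes a u x :: real
  assumes a: "0 < a" "a < 1" and u: "0 \<le> u" and x: "u \<le> x"
  shows "(1 - a) * (u - exp (- x) * (exp u - 1))
    \<le> (1 + a * u) * ((1 - exp (- a * x)) / a - (1 - exp (- x)))"
proof -
  define B where "B = (1 + a * u) + (1 - a) * (exp u - 1)"
  define G where "G t = (1 - a) / a - (1 + a * u) / a * exp (- a * t) + B * exp (- t)" for t
  have au: "0 < 1 + a * u" using a u by (simp add: add_pos_nonneg)
  have B: "0 < B" unfolding B_def using au a u by (intro add_pos_nonneg mult_nonneg_nonneg) auto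
  have G_eq: "G t = (1 + a * u) * ((1 - exp (- a * t)) / a - (1 - exp (- t)))
      - (1 - a) * (u - exp (- t) * (exp u - 1))" for t
    unfolding G_def B_def using a by (simp add: field_simps)
  \<comment> \<open>the critical point of \<open>G\<close>, where it is minimal\<close>
  define x0 where "x0 = ln (B / (1 + a * u)) / (1 - a)"
  have x0: "B * exp (- x0) = (1 + a * u) * exp (- a * x0)"
  proof -
    have "B / (1 + a * u) = exp ((1 - a) * x0)"
      unfolding x0_def using a B au by simp
    then have "B = (1 + a * u) * exp ((1 - a) * x0)" using au by (simp add: field_simps)
    then show ?thesis by (simp add: exp_add[symmetric] mult.assoc algebra_simps)
  qed
  have G0: "0 \<le> G (max u x0)"
  proof (cases "u \<le> x0")
    case True
    have "1 + a * u \<le> exp (a * u)" by (rule exp_ge_add_one_self)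
    also have "\<dots> \<le> exp (a * x0)" using True a by simp
    finally have "(1 + a * u) * exp (- a * x0) \<le> 1" by (simp add: exp_minus field_simps)
    moreover have "G x0 = (1 - a) / a * (1 - (1 + a * u) * exp (- a * x0))"
      unfolding G_def x0 using a by (simp add: field_simps)
    ultimately show ?thesis using True a by (simp add: max_def)
  next
    case False
    \<comment> \<open>If the critical point lies left of \<open>u\<close>, the minimum over x \<ge>
      u is at the endpoint, which \<open>hellinger_gap_pos\<close> covers.\<close>
    have "exp (-u) * exp u = 1" by (simp flip: exp_add)
    then have *: "u - exp (- u) * (exp u - 1) = u - 1 + exp (- u)" by (simp add: algebra_simps)
    have "max u x0 = u" using False by simp
    then show ?thesis using hellinger_gap_pos[OF a u]
      by (simp only: G_eq * diff_ge_0_iff_ge)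
  qed
  show ?thesis
  proof (cases "x \<le> x0")
    case True
    \<comment> \<open>Left of the critical point \<open>B * exp (- x)\<close> is at least
      \<open>(1 + a * u) * exp (- a * x)\<close>; after this replacement the bound
      \<open>1 + a * u \<le> exp (a * x)\<close> suffices.\<close>
    have "1 + a * u \<le> exp (a * u)" by (rule exp_ge_add_one_self)
    also have "\<dots> \<le> exp (a * x)" using x a by simp
    finally have 1: "(1 + a * u) * exp (- a * x) \<le> 1" by (simp add: exp_minus field_simps)
    have "(1 + a * u) * exp (- a * x) = (1 + a * u) * exp (- a * x0) * exp (a * (x0 - x))"
      by (simp add: exp_add[symmetric] mult.assoc algebra_simps)
    also have "\<dots> \<le> (1 + a * u) * exp (- a * x0) * exp (x0 - x)"
      using au a True by (intro mult_left_mono) (auto simp: mult_left_le_one_le)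
    also have "\<dots> = B * exp (- x)"
      unfolding x0[symmetric] by (simp add: exp_add[symmetric] mult.assoc)
    finally have "(1 - a) / a - (1 + a * u) / a * exp (- a * x) + (1 + a * u) * exp (- a * x) \<le> G x"
      unfolding G_def by simp
    moreover have "(1 - a) / a - (1 + a * u) / a * exp (- a * x) + (1 + a * u) * exp (- a * x)
        = (1 - a) / a * (1 - (1 + a * u) * exp (- a * x))"
      using a by (simp add: field_simps)
    moreover have "(1 - a) / a * (1 - (1 + a * u) * exp (- a * x)) \<ge> 0"
      using 1 a by simp
    ultimately show ?thesis using G_eq[of x] by linarith
  next
    case False
    have "G (max u x0) \<le> G x"
    proof (rule DERIV_nonneg_imp_nondecreasing[of "max u x0" x G])
      show "max u x0 \<le> x" using x False by simp
      fix t assume t: "max u x0 \<le> t"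
      have "DERIV G t :> (1 + a * u) * exp (- a * t) - B * exp (- t)"
        unfolding G_def using a by (auto intro!: derivative_eq_intros)
      moreover have "B * exp (- t) \<le> (1 + a * u) * exp (- a * t)"
      proof -
        have "B * exp (- t) = B * exp (- x0) * exp (x0 - t)"
          by (simp add: exp_add[symmetric] mult.assoc)
        also have "\<dots> = (1 + a * u) * exp (- a * x0) * exp (x0 - t)" by (simp only: x0)
        also have "\<dots> \<le> (1 + a * u) * exp (- a * x0) * exp (a * (x0 - t))"
        proof (intro mult_left_mono)
          have "(1 - a) * (x0 - t) \<le> 0" using a t by (simp add: mult_le_0_iff)
          then show "exp (x0 - t) \<le> exp (a * (x0 - t))" by (simp add: algebra_simps)
        qed (use au in auto)
        also have "\<dots> = (1 + a * u) * exp (- a * t)"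
          by (simp add: exp_add[symmetric] mult.assoc algebra_simps)
        finally show ?thesis .
      qed
      ultimately show "\<exists>y. DERIV G t :> y \<and> 0 \<le> y" by force
    qed
    then show ?thesis using G0 G_eq[of x] by linarith
  qed
qed

lemma hellinger_gap_normalized:
  fixes a u x y :: real
  assumes a: "0 < a" "a < 1" and u: "0 \<le> u" and xy: "x - y \<le> u"
  shows "(1 - a) * ((x - 1 + exp (- x)) - (y - 1 + exp (- y)))
    \<le> (1 + a * u) * ((1 - exp (- a * x)) / a - (1 - exp (- x)))"
    (is "_ * (?r x - ?r y) \<le> _ * ?S")
proof -
  have S: "0 \<le> ?S" using exp_weighted_mean[of a x] a by (simp add: field_simps)
  have r: "0 \<le> ?r y" using exp_ge_add_one_self[of "- y"] by simp
  then have r': "(1 - a) * (?r x - ?r y) \<le> (1 - a) * ?r x" using a by (intro mult_left_mono) auto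
  consider "x \<le> 0" | "0 \<le> x" "x \<le> u" | "u \<le> x" by linarith
  then show ?thesis
  proof cases
    case 1
    have "(1 - a) * ?r x \<le> 1 * ?S" using hellinger_gap_neg[OF a 1] by simp
    also have "\<dots> \<le> (1 + a * u) * ?S" using S a u by (intro mult_right_mono) auto
    finally show ?thesis using r' by linarith
  next
    case 2
    have "(1 - a) * ?r x \<le> (1 + a * x) * ?S" by (rule hellinger_gap_pos[OF a 2(1)])
    also have "\<dots> \<le> (1 + a * u) * ?S" using S a 2 by (intro mult_right_mono) auto
    finally show ?thesis using r' by linarith
  next
    case 3
    \<comment> \<open>The tangent line of \<open>exp\<close> at \<open>u - x\<close> yields
      \<open>?r (x - u) \<le> ?r y\<close>.\<close>
    have "exp (u - x) * (1 + (x - u - y)) \<le> exp (u - x) * exp (x - u - y)"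
      by (intro mult_left_mono exp_ge_add_one_self) auto
    then have 1: "exp (u - x) * (1 + (x - u - y)) \<le> exp (- y)" by (simp flip: exp_add)
    have "0 \<le> (1 - exp (u - x)) * (y - (x - u))" using 3 xy by simp
    then have "x - u + exp (u - x) \<le> y + exp (u - x) * (1 + (x - u - y))" by (simp add: algebra_simps)
    with 1 have "x - u + exp (u - x) \<le> y + exp (- y)" by linarith
    moreover have "exp (u - x) = exp (- x) * exp u" by (simp flip: exp_add)
    ultimately have "?r x - ?r y \<le> u - exp (- x) * (exp u - 1)" by (simp add: algebra_simps)
    then have "(1 - a) * (?r x - ?r y) \<le> (1 - a) * (u - exp (- x) * (exp u - 1))"
      using a by (intro mult_left_mono) auto
    then show ?thesis using hellinger_gap_large[OF a u 3] by linarith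
  qed
qed

text \<open>A concave substitute for x: for a > 0 it is bounded above by \<open>1 / a\<close>,
  increases as a decreases, and has its expectation determined by the exponential moment of order
  a.\<close>

definition hellinger :: "real \<Rightarrow> real \<Rightarrow> real" where
  "hellinger a x = (1 - exp (- a * x)) / a"

lemma hellinger_mono: "0 < a \<Longrightarrow> x \<le> y \<Longrightarrow> hellinger a x \<le> hellinger a y"
  by (simp add: hellinger_def divide_right_mono)

lemma hellinger_antimono:
  assumes "0 < a" "a \<le> b"
  shows "hellinger b x \<le> hellinger a x"
proof -
  have "b * exp (- a * x) \<le> b * (a / b * exp (- b * x) + (1 - a / b))"
    using exp_weighted_mean[of "a / b" "b * x"] assms by (intro mult_left_mono) auto
  also have "\<dots> = a * exp (- b * x) + (b - a)" using assms by (simp add: algebra_simps)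
  finally show ?thesis using assms by (simp add: hellinger_def field_simps)
qed

text \<open>Scaling x, y, u by k and replacing a by \<open>a / k\<close> reduces this to
  \<open>hellinger_gap_normalized\<close>. The \<open>hellinger k\<close> terms are kept apart
  because the projection later gives them nonnegative expectation, so that with C \<ge> 1 they only
  help.\<close>

lemma truncated_diff_le_hellinger:
  fixes a k u x y :: real
  assumes a: "0 < a" "a < k" and u: "0 \<le> u"
  defines "C \<equiv> (a * u + 1) / (1 - a / k)"
  shows "(x - y) * indicator {..u} (x - y) \<le> C * (hellinger a x - hellinger k x) + hellinger k x - hellinger k y"
proof (cases "x - y \<le> u")
  case True
  have k: "0 < k" using a by simp
  have ak: "a / k < 1" using a k by simp
  have r: "k * z - 1 + exp (- (k * z)) = k * (z - hellinger k z)" for z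
    using k by (simp add: hellinger_def field_simps)
  have S: "(1 - exp (- (a / k) * (k * x))) / (a / k) - (1 - exp (- (k * x)))
      = k * (hellinger a x - hellinger k x)"
    using a k by (simp add: hellinger_def field_simps)
  define q where "q = 1 - a / k"
  have C: "1 + a / k * (k * u) = q * C" and q: "0 < q"
    using k ak unfolding C_def q_def by simp_all
  have "(1 - a / k) * ((k * x - 1 + exp (- (k * x))) - (k * y - 1 + exp (- (k * y))))
    \<le> (1 + a / k * (k * u)) * ((1 - exp (- (a / k) * (k * x))) / (a / k) - (1 - exp (- (k * x))))"
    by (rule hellinger_gap_normalized) (use a k u True in \<open>auto simp flip: right_diff_distrib\<close>)
  then have "q * (k * (x - hellinger k x - (y - hellinger k y))) \<le> q * (k * (C * (hellinger a x - hellinger k x)))"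
    unfolding r S C q_def[symmetric] by (simp add: algebra_simps)
  then have "x - hellinger k x - (y - hellinger k y) \<le> C * (hellinger a x - hellinger k x)"
    using k q by simp
  then show ?thesis using True by simp
next
  case False
  have k: "0 < k" using a by simp
  have C: "0 \<le> C" unfolding C_def using a u k by simp
  have "hellinger k y \<le> hellinger k x" using False u k by (intro hellinger_mono) auto
  moreover have "0 \<le> C * (hellinger a x - hellinger k x)"
    using hellinger_antimono[of a k x] a C by simp
  ultimately show ?thesis using False by simp
qed

subsection \<open>Reversed information projection\<close>

text \<open>The Gibbs variational bound for a fair sign: tilting the two signs to weights
  \<open>(1 + s) / 2\<close> and \<open>(1 - s) / 2\<close> gives mean s and costs relative entropy
  at most \<open>s\<^sup>2\<close>.\<close>

lemma ln_cosh_ge: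
  fixes s x :: real
  assumes s: "0 \<le> s" "s < 1"
  shows "s * \<bar>x\<bar> - s\<^sup>2 \<le> ln (cosh x)"
proof -
  define y where "y = \<bar>x\<bar>"
  \<comment> \<open>\<open>A\<close> and \<open>B\<close> are chosen so that
    \<open>E * (1 + s) * exp A = exp y\<close> and \<open>E * (1 - s) * exp B = exp (- y)\<close>;
    then \<open>1 + t \<le> exp t\<close> is applied to each.\<close>
  define E where "E = exp (s * y - s\<^sup>2)"
  define A where "A = (1 - s) * y + s\<^sup>2 - ln (1 + s)"
  define B where "B = - (1 + s) * y + s\<^sup>2 - ln (1 - s)"
  have "(1 + s) * ln (1 + s) \<le> (1 + s) * s"
    using s by (intro mult_left_mono ln_add_one_self_le_self) auto
  moreover have "(1 - s) * ln (1 - s) \<le> (1 - s) * (- s)"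
    using s ln_one_minus_pos_upper_bound[of s] by (intro mult_left_mono) auto
  ultimately have "2 \<le> (1 + s) * (1 + A) + (1 - s) * (1 + B)"
    unfolding A_def B_def by (simp add: algebra_simps power2_eq_square)
  also have "\<dots> \<le> (1 + s) * exp A + (1 - s) * exp B"
    using s by (intro add_mono mult_left_mono exp_ge_add_one_self) auto
  also have "(1 + s) * exp A = exp (ln (1 + s) + A)" using s by (simp add: exp_add)
  also have "(1 - s) * exp B = exp (ln (1 - s) + B)" using s by (simp add: exp_add)
  finally have "E * 2 \<le> E * (exp (ln (1 + s) + A) + exp (ln (1 - s) + B))"
    unfolding E_def by simp
  also have "\<dots> = exp y + exp (- y)"
  proof -
    have "s * y - s\<^sup>2 + (ln (1 + s) + A) = y" "s * y - s\<^sup>2 + (ln (1 - s) + B) = - y"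
      unfolding A_def B_def by (simp_all add: algebra_simps)
    then show ?thesis unfolding E_def distrib_left exp_add[symmetric] by simp
  qed
  finally have "E \<le> cosh y" by (simp add: cosh_field_def)
  then have "ln E \<le> ln (cosh y)" by (intro ln_mono) (auto simp: E_def)
  then show ?thesis by (simp add: E_def y_def)
qed

lemma ln_half_sum_exp:
  fixes a b :: real
  shows "- ln (exp (- a) / 2 + exp (- b) / 2) = (a + b) / 2 - ln (cosh ((a - b) / 2))"
proof -
  have "exp (- a) / 2 + exp (- b) / 2 = exp (- (a + b) / 2) * cosh ((a - b) / 2)"
  proof -
    have "- (a + b) / 2 + (a - b) / 2 = - b" "- (a + b) / 2 + - ((a - b) / 2) = - a"
      by (simp_all add: field_simps)
    then show ?thesis
      unfolding cosh_field_def times_divide_eq_right distrib_left exp_add[symmetric]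
      by (simp add: add_divide_distrib)
  qed
  then show ?thesis by (simp add: ln_mult field_simps)
qed

text \<open>Monotone convergence gives the sum of absolute values a finite integral, so it is finite
  almost everywhere.\<close>

lemma AE_summable_of_summable_integral:
  fixes f :: "nat \<Rightarrow> 'a \<Rightarrow> real"
  assumes f: "\<And>i. integrable M (f i)" and S: "summable (\<lambda>i. \<integral>x. \<bar>f i x\<bar> \<partial>M)"
  shows "AE x in M. summable (\<lambda>i. \<bar>f i x\<bar>)"
proof -
  note [measurable] = borel_measurable_integrable[OF f]
  have "(\<integral>\<^sup>+x. (\<Sum>i. ennreal \<bar>f i x\<bar>) \<partial>M) = (\<Sum>i. \<integral>\<^sup>+x. ennreal \<bar>f i x\<bar> \<partial>M)"
    by (intro nn_integral_suminf) auto
  also have "\<dots> = (\<Sum>i. ennreal (\<integral>x. \<bar>f i x\<bar> \<partial>M))"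
    using f by (simp add: nn_integral_eq_integral)
  also have "\<dots> \<noteq> \<infinity>"
    by (subst suminf_ennreal2[OF _ S]) auto
  finally have "AE x in M. (\<Sum>i. ennreal \<bar>f i x\<bar>) \<noteq> \<infinity>"
    by (intro nn_integral_PInf_AE) auto
  then show ?thesis
    by eventually_elim (auto intro!: summable_suminf_not_top)
qed

text \<open>The limit is a derivative at t = 0. Subtracting \<open>ln (1 - t)\<close> keeps the
  quotients nonnegative for R \<ge> 0, as Fatou's lemma requires, and
  \<open>1 / (real j + 2)\<close> stays strictly between 0 and 1.\<close>

lemma log_mix_limit:
  fixes R :: real
  shows "(\<lambda>j. (ln (1 - 1 / (real j + 2) + 1 / (real j + 2) * R) - ln (1 - 1 / (real j + 2)))
     / (1 / (real j + 2))) \<longlonglongrightarrow> R"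
proof -
  have "(\<lambda>t. (ln (1 - t + t * R) - ln (1 - t)) / t) \<midarrow>0\<rightarrow> R"
  proof -
    have "DERIV (\<lambda>t. ln (1 - t + t * R) - ln (1 - t)) 0 :> R"
      by (auto intro!: derivative_eq_intros)
    then show ?thesis by (simp add: DERIV_def)
  qed
  moreover have "filterlim (\<lambda>j. 1 / (real j + 2)) (at 0) sequentially"
    by real_asymp
  ultimately show ?thesis by (rule filterlim_compose)
qed

text \<open>The elements of \<open>G\<close> act as negative log likelihoods; \<open>mix\<close>
  says that the likelihoods \<open>exp (- g x)\<close> are closed under convex combinations. The
  last conclusion is first-order optimality of m: moving a weight t towards g cannot lower the
  expectation below the infimum, and dividing by t and letting t tend to 0 bounds the likelihood
  ratio.\<close>

theorem (in prob_space) reversed_information_projection: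
  fixes G :: "('a \<Rightarrow> real) set"
  assumes ne: "G \<noteq> {}"
    and int: "\<And>g. g \<in> G \<Longrightarrow> integrable M g"
    and mix: "\<And>g h t. g \<in> G \<Longrightarrow> h \<in> G \<Longrightarrow> 0 < t \<Longrightarrow> t < 1 \<Longrightarrow>
      (\<lambda>x. - ln ((1 - t) * exp (- g x) + t * exp (- h x))) \<in> G"
    and bdd: "bdd_below ((\<lambda>g. \<integral>x. g x \<partial>M) ` G)"
  obtains m where "integrable M m" "(\<integral>x. m x \<partial>M) = (INF g\<in>G. \<integral>x. g x \<partial>M)"
    "\<And>g. g \<in> G \<Longrightarrow> (\<integral>\<^sup>+x. exp (m x - g x) \<partial>M) \<le> 1"
proof -
  define I where "I = (INF g\<in>G. \<integral>x. g x \<partial>M)"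
  have I: "I \<le> (\<integral>x. g x \<partial>M)" if "g \<in> G" for g
    unfolding I_def using bdd that by (rule cINF_lower)
  \<comment> \<open>The near-minimizers are taken within \<open>(s k)\<^sup>2\<close> of
    \<open>I\<close> because \<open>ln_cosh_ge\<close> with slope \<open>s k\<close> loses the same
    amount; dividing by \<open>s k\<close> leaves an L1 distance of order \<open>s k\<close>, which
    is summable.\<close>
  define s :: "nat \<Rightarrow> real" where "s k = (1 / 2) ^ Suc k" for k
  have s: "0 < s k" "s k < 1" "s (Suc k) \<le> s k" for k
    by (auto simp: s_def power_less_one_iff simp del: power_Suc intro!: power_decreasing)
  have "\<exists>g\<in>G. (\<integral>x. g x \<partial>M) < I + (s k)\<^sup>2" for k
    using cINF_less_iff[OF ne bdd, of "I + (s k)\<^sup>2"] s[of k] by (simp add: I_def)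
  then obtain g where gG: "\<And>k. g k \<in> G" and g: "\<And>k. (\<integral>x. g k x \<partial>M) < I + (s k)\<^sup>2"
    by metis
  note gi = int[OF gG]
  define f where "f k x = g (Suc k) x - g k x" for k x
  have fi: "integrable M (f k)" for k unfolding f_def using gi by simp
  \<comment> \<open>compare both losses with their mixture, whose expectation is at least \<open>I\<close>\<close>
  have fb: "(\<integral>x. \<bar>f k x\<bar> \<partial>M) \<le> 4 * s k" for k
  proof -
    let ?h = "\<lambda>x. - ln ((1 - 1 / 2) * exp (- g (Suc k) x) + 1 / 2 * exp (- g k x))"
    have hG: "?h \<in> G" by (intro mix gG) auto
    have "s k * (\<bar>f k x\<bar> / 2) - (s k)\<^sup>2 \<le> (g (Suc k) x + g k x) / 2 - ?h x" for x
      using ln_cosh_ge[of "s k" "f k x / 2"] s[of k] ln_half_sum_exp[of "g (Suc k) x" "g k x"]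
      by (simp add: f_def)
    then have "(\<integral>x. s k * (\<bar>f k x\<bar> / 2) - (s k)\<^sup>2 \<partial>M) \<le> (\<integral>x. (g (Suc k) x + g k x) / 2 - ?h x \<partial>M)"
      by (intro integral_mono Bochner_Integration.integrable_diff integrable_mult_right)
        (use fi gi int[OF hG] in auto)
    also have "\<dots> = ((\<integral>x. g (Suc k) x \<partial>M) + (\<integral>x. g k x \<partial>M)) / 2 - (\<integral>x. ?h x \<partial>M)"
      by (subst Bochner_Integration.integral_diff) (use gi int[OF hG] in auto)
    also have "\<dots> \<le> (s k)\<^sup>2"
    proof -
      have "(s (Suc k))\<^sup>2 \<le> (s k)\<^sup>2" using s[of k] s[of "Suc k"] by (intro power_mono) auto
      moreover have "(q + p) / 2 - e \<le> d"
        if "p < I + d" "q < I + d'" "d' \<le> d" "I \<le> e" for p q e d d' :: real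
        using that by (simp add: field_simps)
      ultimately show ?thesis using g[of k] g[of "Suc k"] I[OF hG] by blast
    qed
    also have "(\<integral>x. s k * (\<bar>f k x\<bar> / 2) - (s k)\<^sup>2 \<partial>M) = s k * ((\<integral>x. \<bar>f k x\<bar> \<partial>M) / 2) - (s k)\<^sup>2"
      by (subst Bochner_Integration.integral_diff) (use fi in \<open>auto simp: prob_space\<close>)
    finally have "s k * (\<integral>x. \<bar>f k x\<bar> \<partial>M) \<le> s k * (4 * s k)"
      by (simp add: power2_eq_square)
    then show ?thesis using s[of k] by simp
  qed
  have "summable (\<lambda>k. 4 * s k)"
    unfolding s_def by (intro summable_mult summable_ignore_initial_segment[of _ 1, simplified] summable_geometric) auto
  then have fS: "summable (\<lambda>k. \<integral>x. \<bar>f k x\<bar> \<partial>M)"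
    by (rule summable_comparison_test') (use fb in auto)
  have fA: "AE x in M. summable (\<lambda>k. norm (f k x))"
    using AE_summable_of_summable_integral[OF fi fS] by simp
  \<comment> \<open>A telescoping series: \<open>g 0\<close> plus its n-th partial sum is
    \<open>g n\<close>, so m is the almost everywhere limit of the minimizing sequence and can be
    integrated termwise.\<close>
  define m where "m x = g 0 x + (\<Sum>k. f k x)" for x
  have f_int: "integrable M (\<lambda>x. \<Sum>k. f k x)" "(\<integral>x. (\<Sum>k. f k x) \<partial>M) = (\<Sum>k. \<integral>x. f k x \<partial>M)"
    using integrable_suminf[OF fi fA] integral_suminf[OF fi fA] fS by simp_all
  have mi: "integrable M m" unfolding m_def using gi f_int by simp
  have glim: "AE x in M. (\<lambda>k. g k x) \<longlonglongrightarrow> m x"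
    using fA
  proof eventually_elim
    case (elim x)
    have "(\<Sum>k<n. f k x) = g n x - g 0 x" for n
      unfolding f_def by (rule sum_lessThan_telescope)
    moreover have "(\<lambda>n. \<Sum>k<n. f k x) \<longlonglongrightarrow> (\<Sum>k. f k x)"
      using summable_LIMSEQ[OF summable_norm_cancel[OF elim]] .
    ultimately have "(\<lambda>n. g 0 x + (g n x - g 0 x)) \<longlonglongrightarrow> m x"
      unfolding m_def by (intro tendsto_add) auto
    then show ?case by simp
  qed
  have mI: "(\<integral>x. m x \<partial>M) = I"
  proof -
    have "(\<Sum>k<n. \<integral>x. f k x \<partial>M) = (\<integral>x. g n x \<partial>M) - (\<integral>x. g 0 x \<partial>M)" for n
      unfolding f_def using gi sum_lessThan_telescope[of "\<lambda>k. \<integral>x. g k x \<partial>M" n] by simp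
    moreover have "summable (\<lambda>k. \<integral>x. f k x \<partial>M)"
      by (rule summable_norm_cancel, rule summable_comparison_test'[OF fS])
        (auto intro: integral_abs_bound)
    ultimately have "(\<lambda>n. (\<integral>x. g 0 x \<partial>M) + ((\<integral>x. g n x \<partial>M) - (\<integral>x. g 0 x \<partial>M)))
        \<longlonglongrightarrow> (\<integral>x. g 0 x \<partial>M) + (\<Sum>k. \<integral>x. f k x \<partial>M)"
      using summable_LIMSEQ by (intro tendsto_add) fastforce+
    also have "(\<integral>x. g 0 x \<partial>M) + (\<Sum>k. \<integral>x. f k x \<partial>M) = (\<integral>x. m x \<partial>M)"
      unfolding m_def using gi f_int by simp
    finally have "(\<lambda>n. \<integral>x. g n x \<partial>M) \<longlonglongrightarrow> (\<integral>x. m x \<partial>M)" by simp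
    moreover have "(\<lambda>n. \<integral>x. g n x \<partial>M) \<longlonglongrightarrow> I"
    proof (rule tendsto_sandwich[of "\<lambda>_. I" _ _ "\<lambda>n. I + (s n)\<^sup>2"])
      show "(\<lambda>n. I + (s n)\<^sup>2) \<longlonglongrightarrow> I" unfolding s_def by real_asymp
    qed (use I[OF gG] g in \<open>auto intro!: always_eventually less_imp_le\<close>)
    ultimately show ?thesis by (rule LIMSEQ_unique)
  qed
  have "(\<integral>\<^sup>+x. exp (m x - h x) \<partial>M) \<le> 1" if hG: "h \<in> G" for h
  proof -
    note hi = int[OF hG]
    note [measurable] = borel_measurable_integrable[OF hi] borel_measurable_integrable[OF gi]
      borel_measurable_integrable[OF mi]
    \<comment> \<open>At a fixed weight t the mixture \<open>H\<close> of \<open>g k\<close> and h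
      has expectation at least \<open>I\<close>, while \<open>g k\<close> exceeds \<open>I\<close>
      by less than \<open>(s k)\<^sup>2\<close>. Fatou's lemma in k then replaces \<open>g k\<close>
      by m.\<close>
    have 1: "(\<integral>\<^sup>+x. ennreal (ln (1 - t + t * exp (m x - h x)) - ln (1 - t)) \<partial>M) \<le> ennreal (- ln (1 - t))"
      if t: "0 < t" "t < 1" for t
    proof -
      define \<phi> where "\<phi> y = ln (1 - t + t * exp y) - ln (1 - t)" for y :: real
      have \<phi>0: "0 \<le> \<phi> y" for y
        using t by (auto simp: \<phi>_def intro!: ln_mono)
      have \<phi>c: "isCont \<phi> y" for y
      proof -
        have "0 < 1 - t + t * exp y" using t by (intro add_pos_nonneg) auto
        then show ?thesis unfolding \<phi>_def by (intro continuous_intros) auto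
      qed
      have le: "(\<integral>\<^sup>+x. ennreal (\<phi> (g k x - h x)) \<partial>M) \<le> ennreal ((s k)\<^sup>2 - ln (1 - t))" for k
      proof -
        define H where "H x = - ln ((1 - t) * exp (- g k x) + t * exp (- h x))" for x
        have HG: "H \<in> G" unfolding H_def using mix[OF gG hG t] .
        have eq: "\<phi> (g k x - h x) = g k x - H x - ln (1 - t)" for x
        proof -
          have *: "exp (- g k x) * exp (g k x - h x) = exp (- h x)" by (simp flip: exp_add)
          have "(1 - t) * exp (- g k x) + t * exp (- h x)
              = exp (- g k x) * (1 - t + t * exp (g k x - h x))"
            unfolding *[symmetric] by (simp only: algebra_simps)
          moreover have "0 < 1 - t + t * exp (g k x - h x)" using t by (intro add_pos_nonneg) auto
          ultimately show ?thesis by (simp add: \<phi>_def H_def ln_mult)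
        qed
        have i: "integrable M (\<lambda>x. \<phi> (g k x - h x))"
          unfolding eq using gi[of k] int[OF HG] by (intro Bochner_Integration.integrable_diff) auto
        have "(\<integral>x. \<phi> (g k x - h x) \<partial>M) = (\<integral>x. g k x \<partial>M) - (\<integral>x. H x \<partial>M) - ln (1 - t)"
          unfolding eq using gi[of k] int[OF HG] by (simp add: prob_space)
        also have "\<dots> \<le> (s k)\<^sup>2 - ln (1 - t)" using g[of k] I[OF HG] by linarith
        finally show ?thesis using i \<phi>0 by (subst nn_integral_eq_integral) (auto intro: ennreal_leI)
      qed
      have "(\<integral>\<^sup>+x. ennreal (\<phi> (m x - h x)) \<partial>M) = (\<integral>\<^sup>+x. liminf (\<lambda>k. ennreal (\<phi> (g k x - h x))) \<partial>M)"
      proof (rule nn_integral_cong_AE)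
        show "AE x in M. ennreal (\<phi> (m x - h x)) = liminf (\<lambda>k. ennreal (\<phi> (g k x - h x)))"
          using glim
        proof eventually_elim
          case (elim x)
          have "(\<lambda>k. ennreal (\<phi> (g k x - h x))) \<longlonglongrightarrow> ennreal (\<phi> (m x - h x))"
            by (intro tendsto_ennrealI isCont_tendsto_compose[OF \<phi>c] tendsto_diff elim tendsto_const)
          then show ?case by (simp add: lim_imp_Liminf)
        qed
      qed
      also have "\<dots> \<le> liminf (\<lambda>k. \<integral>\<^sup>+x. ennreal (\<phi> (g k x - h x)) \<partial>M)"
        unfolding \<phi>_def by (intro nn_integral_liminf) measurable
      also have "\<dots> \<le> liminf (\<lambda>k. ennreal ((s k)\<^sup>2 - ln (1 - t)))"
        by (intro Liminf_mono always_eventually allI le)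
      also have "\<dots> = ennreal (- ln (1 - t))"
      proof (rule lim_imp_Liminf)
        have "(\<lambda>k. (s k)\<^sup>2) \<longlonglongrightarrow> 0" unfolding s_def by real_asymp
        then have "(\<lambda>k. ennreal ((s k)\<^sup>2 - ln (1 - t))) \<longlonglongrightarrow> ennreal (0 - ln (1 - t))"
          by (intro tendsto_ennrealI tendsto_diff) auto
        then show "(\<lambda>k. ennreal ((s k)\<^sup>2 - ln (1 - t))) \<longlonglongrightarrow> ennreal (- ln (1 - t))" by simp
      qed simp
      finally show ?thesis unfolding \<phi>_def .
    qed
    \<comment> \<open>Fatou's lemma again, now along weights tending to 0, where
      \<open>- ln (1 - T j) / T j\<close> tends to 1.\<close>
    define T :: "nat \<Rightarrow> real" where "T j = 1 / (real j + 2)" for j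
    have T: "0 < T j" "T j < 1" for j by (auto simp: T_def)
    have "(\<integral>\<^sup>+x. exp (m x - h x) \<partial>M)
        = (\<integral>\<^sup>+x. liminf (\<lambda>j. ennreal ((ln (1 - T j + T j * exp (m x - h x)) - ln (1 - T j)) / T j)) \<partial>M)"
      using log_mix_limit unfolding T_def
      by (intro nn_integral_cong lim_imp_Liminf[symmetric] tendsto_ennrealI) auto
    also have "\<dots> \<le> liminf (\<lambda>j. \<integral>\<^sup>+x. ennreal ((ln (1 - T j + T j * exp (m x - h x)) - ln (1 - T j)) / T j) \<partial>M)"
      by (intro nn_integral_liminf) measurable
    also have "\<dots> \<le> liminf (\<lambda>j. ennreal (- ln (1 - T j) / T j))"
    proof (intro Liminf_mono always_eventually allI)
      fix j
      have "(\<integral>\<^sup>+x. ennreal ((ln (1 - T j + T j * exp (m x - h x)) - ln (1 - T j)) / T j) \<partial>M)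
        = (\<integral>\<^sup>+x. ennreal (ln (1 - T j + T j * exp (m x - h x)) - ln (1 - T j)) * ennreal (1 / T j) \<partial>M)"
        using T[of j] by (intro nn_integral_cong) (auto simp flip: ennreal_mult'')
      also have "\<dots> \<le> ennreal (- ln (1 - T j)) * ennreal (1 / T j)"
        using 1[OF T[of j]] by (subst nn_integral_multc) (auto intro!: mult_right_mono)
      also have "\<dots> = ennreal (- ln (1 - T j) / T j)"
        using T[of j] by (auto simp flip: ennreal_mult'')
      finally show "(\<integral>\<^sup>+x. ennreal ((ln (1 - T j + T j * exp (m x - h x)) - ln (1 - T j)) / T j) \<partial>M)
        \<le> ennreal (- ln (1 - T j) / T j)" .
    qed
    also have "\<dots> = ennreal 1"
    proof (rule lim_imp_Liminf)
      have "(\<lambda>j. - ln (1 - T j) / T j) \<longlonglongrightarrow> 1" unfolding T_def by real_asymp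
      then show "(\<lambda>j. ennreal (- ln (1 - T j) / T j)) \<longlonglongrightarrow> ennreal 1" by (rule tendsto_ennrealI)
    qed simp
    finally show ?thesis by simp
  qed
  then show thesis using that mi mI unfolding I_def by blast
qed

subsection \<open>Extended expectations and change of measure\<close>

text \<open>Both halves are monotone even without measurability, and so is extended subtraction
  under the convention for infinity minus infinity. This allows integrands that may fail to be
  measurable.\<close>

lemma ereal_expectation_mono_AE:
  assumes "AE x in M. X x \<le> Y x"
  shows "ereal_expectation M X \<le> ereal_expectation M Y"
  unfolding ereal_expectation_def
proof (rule ereal_minus_mono)
  show "enn2ereal (\<integral>\<^sup>+ x. e2ennreal (X x) \<partial>M) \<le> enn2ereal (\<integral>\<^sup>+ x. e2ennreal (Y x) \<partial>M)"
    using assms by (intro less_eq_ennreal.rep_eq[THEN iffD1] nn_integral_mono_AE) (auto intro!: e2ennreal_mono simp: ereal_minus_le_minus)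
  show "enn2ereal (\<integral>\<^sup>+ x. e2ennreal (- Y x) \<partial>M) \<le> enn2ereal (\<integral>\<^sup>+ x. e2ennreal (- X x) \<partial>M)"
    using assms by (intro less_eq_ennreal.rep_eq[THEN iffD1] nn_integral_mono_AE) (auto intro!: e2ennreal_mono simp: ereal_minus_le_minus)
qed

lemma ereal_expectation_cong_AE:
  assumes "AE x in M. X x = Y x"
  shows "ereal_expectation M X = ereal_expectation M Y"
  using assms by (intro antisym ereal_expectation_mono_AE) auto

lemma ereal_expectation_integrable:
  assumes g: "integrable M g" and X: "AE x in M. X x = ereal (g x)"
  shows "ereal_expectation M X = ereal (\<integral>x. g x \<partial>M)"
proof -
  have *: "(\<integral>\<^sup>+ x. ennreal (h x) \<partial>M) < \<infinity>" if "integrable M h" for h :: "_ \<Rightarrow> real"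
    using real_integrable_def[of M h] that by (simp add: less_top)
  have "ereal_expectation M X = ereal_expectation M (\<lambda>x. ereal (g x))"
    using X by (rule ereal_expectation_cong_AE)
  also have "\<dots> = enn2ereal (\<integral>\<^sup>+ x. ennreal (g x) \<partial>M) - enn2ereal (\<integral>\<^sup>+ x. ennreal (- g x) \<partial>M)"
    by (simp add: ereal_expectation_def)
  also have "\<dots> = ereal (\<integral>x. g x \<partial>M)"
    using *[OF g] *[of "\<lambda>x. - g x"] g
    by (cases "\<integral>\<^sup>+ x. ennreal (g x) \<partial>M" "\<integral>\<^sup>+ x. ennreal (- g x) \<partial>M" rule: ennreal2_cases)
       (auto simp: real_lebesgue_integral_def enn2ereal_ennreal)
  finally show ?thesis .
qed

text \<open>By that convention an infinite positive part forces the value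
  \<open>\<infinity>\<close>, whatever the negative part is.\<close>

lemma ereal_expectation_pos_finite:
  assumes "ereal_expectation M X < \<infinity>"
  shows "(\<integral>\<^sup>+ x. e2ennreal (X x) \<partial>M) < \<infinity>"
proof (rule ccontr)
  assume "\<not> (\<integral>\<^sup>+ x. e2ennreal (X x) \<partial>M) < \<infinity>"
  then have "(\<integral>\<^sup>+ x. e2ennreal (X x) \<partial>M) = top" by (simp add: less_top[symmetric])
  then show False using assms by (simp add: ereal_expectation_def)
qed

lemma ereal_expectation_neg_finite:
  assumes "(\<integral>\<^sup>+ x. e2ennreal (X x) \<partial>M) < \<infinity>" "-\<infinity> < ereal_expectation M X"
  shows "(\<integral>\<^sup>+ x. e2ennreal (- X x) \<partial>M) < \<infinity>"
proof (rule ccontr)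
  assume "\<not> (\<integral>\<^sup>+ x. e2ennreal (- X x) \<partial>M) < \<infinity>"
  then have "(\<integral>\<^sup>+ x. e2ennreal (- X x) \<partial>M) = top" by (simp add: less_top[symmetric])
  then show False using assms
    by (cases "\<integral>\<^sup>+ x. e2ennreal (X x) \<partial>M" rule: ennreal_cases)
       (auto simp: ereal_expectation_def enn2ereal_ennreal)
qed

lemma integrable_real_of_ereal:
  assumes [measurable]: "X \<in> borel_measurable M"
    and pos: "(\<integral>\<^sup>+ x. e2ennreal (X x) \<partial>M) < \<infinity>" and neg: "(\<integral>\<^sup>+ x. e2ennreal (- X x) \<partial>M) < \<infinity>"
  shows "integrable M (\<lambda>x. real_of_ereal (X x))" "AE x in M. X x = ereal (real_of_ereal (X x))"
proof -
  have "AE x in M. e2ennreal (X x) \<noteq> \<infinity>" "AE x in M. e2ennreal (- X x) \<noteq> \<infinity>"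
    using pos neg by (intro nn_integral_PInf_AE; simp)+
  then show AE: "AE x in M. X x = ereal (real_of_ereal (X x))"
  proof eventually_elim
    case (elim x)
    then show ?case by (cases "X x") auto
  qed
  have eq: "(\<integral>\<^sup>+ x. ennreal (real_of_ereal (X x)) \<partial>M) = (\<integral>\<^sup>+ x. e2ennreal (X x) \<partial>M)"
    "(\<integral>\<^sup>+ x. ennreal (- real_of_ereal (X x)) \<partial>M) = (\<integral>\<^sup>+ x. e2ennreal (- X x) \<partial>M)"
    using AE by (auto intro!: nn_integral_cong_AE elim!: eventually_mono)
      (metis ennreal.rep_eq e2ennreal_ereal uminus_ereal.simps(1))+
  show "integrable M (\<lambda>x. real_of_ereal (X x))"
    unfolding real_integrable_def eq using pos neg by auto
qed

lemma integrable_ereal_expectation: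
  assumes "X \<in> borel_measurable M" "-\<infinity> < ereal_expectation M X" "ereal_expectation M X < \<infinity>"
  shows "integrable M (\<lambda>x. real_of_ereal (X x))" "AE x in M. X x = ereal (real_of_ereal (X x))"
  using integrable_real_of_ereal[OF assms(1) ereal_expectation_pos_finite[OF assms(3)]]
    ereal_expectation_neg_finite[OF ereal_expectation_pos_finite[OF assms(3)] assms(2)] by auto

text \<open>The Donsker-Varadhan inequality with \<open>ln x \<le> x - 1\<close> already applied:
  the bound is linear in the exponential moment and can be averaged over samples. It follows from
  \<open>1 + t \<le> exp t\<close> at \<open>t = H x - L x\<close>, where \<open>L\<close> is the
  log density of Q relative to R. \<open>G\<close> agrees with \<open>exp H\<close> only almost
  everywhere under Q, since it will vanish at functions of infinite loss. The first claim controls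
  the positive part of \<open>H\<close> before \<open>H\<close> is known to be integrable.\<close>

lemma KL_variational:
  fixes H :: "'a \<Rightarrow> real"
  assumes R: "prob_space R" and Q: "prob_space Q" and sets: "sets Q = sets R"
    and ac: "absolutely_continuous R Q" and ent: "integrable Q (entropy_density (exp 1) R Q)"
    and [measurable]: "G \<in> borel_measurable R" "H \<in> borel_measurable R"
    and GH: "AE x in Q. G x = ennreal (exp (H x))"
    and fin: "(\<integral>\<^sup>+x. G x \<partial>R) < \<infinity>"
  shows "integrable Q (\<lambda>x. max 0 (H x))"
    and "integrable Q H \<Longrightarrow> (\<integral>x. H x \<partial>Q) \<le> KL_divergence (exp 1) R Q + enn2real (\<integral>\<^sup>+x. G x \<partial>R) - 1"
proof -
  interpret R: prob_space R by fact
  interpret Q: prob_space Q by fact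
  define D where "D = RN_deriv R Q"
  have [measurable]: "D \<in> borel_measurable R" by (simp add: D_def)
  have QD: "density R D = Q"
    unfolding D_def by (rule R.density_RN_deriv[OF ac sets])
  note [measurable_cong] = sets
  have D_pos: "AE x in Q. D x \<noteq> 0"
    unfolding QD[symmetric] by (subst AE_density) auto
  have "AE x in R. D x \<noteq> \<infinity>"
    unfolding D_def by (rule R.RN_deriv_finite[OF Q.sigma_finite_measure ac sets])
  then have D_fin: "AE x in Q. D x \<noteq> \<infinity>"
    unfolding QD[symmetric] by (subst AE_density) auto
  define L where "L = entropy_density (exp 1) R Q"
  have L: "L x = ln (enn2real (D x))" for x
    by (simp add: L_def entropy_density_def D_def log_def)
  define K where "K x = enn2real (G x / D x)" for x
  have [measurable]: "K \<in> borel_measurable R" unfolding K_def by measurable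
  \<comment> \<open>Only an inequality: the mass that \<open>G\<close> has under R where
    \<open>D\<close> vanishes is lost.\<close>
  have nnK: "(\<integral>\<^sup>+x. ennreal (K x) \<partial>Q) \<le> (\<integral>\<^sup>+x. G x \<partial>R)"
  proof -
    have "(\<integral>\<^sup>+x. ennreal (K x) \<partial>Q) \<le> (\<integral>\<^sup>+x. G x / D x \<partial>Q)"
      unfolding K_def by (intro nn_integral_mono) (metis ennreal_enn2real_if order.refl top_greatest)
    also have "\<dots> = (\<integral>\<^sup>+x. D x * (G x / D x) \<partial>R)"
      unfolding QD[symmetric] by (intro nn_integral_density) auto
    also have "\<dots> \<le> (\<integral>\<^sup>+x. G x \<partial>R)"
    proof (intro nn_integral_mono)
      fix x show "D x * (G x / D x) \<le> G x"
      proof (cases "D x = 0 \<or> D x = top")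
        case True
        then show ?thesis by (auto simp: divide_ennreal_def)
      next
        case False
        then show ?thesis by (simp add: ennreal_times_divide mult.commute[of "D x"] mult_divide_eq_ennreal)
      qed
    qed
    finally show ?thesis .
  qed
  have Ki: "integrable Q K"
    using nnK fin by (intro integrableI_nonneg) (auto simp: K_def)
  have K_le: "(\<integral>x. K x \<partial>Q) \<le> enn2real (\<integral>\<^sup>+x. G x \<partial>R)"
    using nnK fin by (subst integral_eq_nn_integral) (auto simp: K_def intro!: enn2real_mono)
  have H_le: "AE x in Q. H x \<le> L x + K x - 1"
    using D_pos D_fin GH
  proof eventually_elim
    case (elim x)
    then obtain d where d: "D x = ennreal d" "0 < d"
      by (cases "D x" rule: ennreal_cases) (auto simp: less_le)
    have K: "K x = exp (H x) / d" unfolding K_def elim d using d by (simp add: divide_ennreal)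
    have "1 + (H x - ln d) \<le> exp (H x - ln d)" by (rule exp_ge_add_one_self)
    also have "\<dots> = K x" unfolding K using d by (simp add: exp_diff)
    finally show ?case unfolding L d using d by simp
  qed
  show "integrable Q (\<lambda>x. max 0 (H x))"
  proof (rule Bochner_Integration.integrable_bound)
    show "integrable Q (\<lambda>x. \<bar>L x\<bar> + K x)" using ent Ki unfolding L_def by simp
    show "AE x in Q. norm (max 0 (H x)) \<le> norm (\<bar>L x\<bar> + K x)"
      using H_le by eventually_elim (auto simp: K_def)
  qed measurable
  assume Hi: "integrable Q H"
  have "(\<integral>x. H x \<partial>Q) \<le> (\<integral>x. L x + K x - 1 \<partial>Q)"
    using Hi H_le Ki ent unfolding L_def[symmetric] by (intro integral_mono_AE) auto
  also have "\<dots> = KL_divergence (exp 1) R Q + (\<integral>x. K x \<partial>Q) - 1"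
    using Ki ent unfolding L_def[symmetric] KL_divergence_def by (simp add: Q.prob_space)
  finally show "(\<integral>x. H x \<partial>Q) \<le> KL_divergence (exp 1) R Q + enn2real (\<integral>\<^sup>+x. G x \<partial>R) - 1"
    using K_le by simp
qed

subsection \<open>Integrability of losses\<close>

lemma prob_algebra_mixture:
  assumes Q: "Q \<in> space (prob_algebra F)" "R \<in> space (prob_algebra F)" and t: "0 < t" "t < 1"
  obtains S where "S \<in> space (prob_algebra F)"
    "\<And>h. h \<in> borel_measurable F \<Longrightarrow>
      (\<integral>\<^sup>+f. h f \<partial>S) = ennreal (1 - t) * (\<integral>\<^sup>+f. h f \<partial>Q) + ennreal t * (\<integral>\<^sup>+f. h f \<partial>R)"
proof
  \<comment> \<open>A coin with bias t chooses between Q and R; written as a bind, the mixture gets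
    its integral and its total mass from the kernel laws.\<close>
  let ?N = "\<lambda>b. if b then R else Q"
  let ?S = "measure_pmf (bernoulli_pmf t) \<bind> ?N"
  have N: "?N \<in> measure_pmf (bernoulli_pmf t) \<rightarrow>\<^sub>M prob_algebra F"
    using Q by (intro measurableI) auto
  have B: "measure_pmf (bernoulli_pmf t) \<in> space (prob_algebra (measure_pmf (bernoulli_pmf t)))"
    by (simp add: space_prob_algebra prob_space_measure_pmf)
  show "?S \<in> space (prob_algebra F)"
    using prob_space_bind'[OF B N] sets_bind'[OF B N] by (simp add: space_prob_algebra)
  show "(\<integral>\<^sup>+f. h f \<partial>?S) = ennreal (1 - t) * (\<integral>\<^sup>+f. h f \<partial>Q) + ennreal t * (\<integral>\<^sup>+f. h f \<partial>R)"
    if "h \<in> borel_measurable F" for h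
    using t by (subst nn_integral_bind[OF that measurable_prob_algebraD[OF N]])
      (simp add: ac_simps)
qed

lemma return_in_prob_algebra: "f \<in> space F \<Longrightarrow> return F f \<in> space (prob_algebra F)"
  by (simp add: space_prob_algebra prob_space_return)

lemma measurable_exp_ereal[measurable]: "exp_ereal \<in> borel_measurable borel"
  unfolding exp_ereal_def[abs_def] by measurable

lemma measurable_ln_ennreal[measurable]: "ln_ennreal \<in> borel_measurable borel"
  unfolding ln_ennreal_def[abs_def] by measurable

lemma exp_ereal_times:
  assumes "0 < k" "x \<noteq> -\<infinity>"
  shows "exp_ereal (ereal (- k) * x) = (if x = \<infinity> then 0 else ennreal (exp (- k * real_of_ereal x)))"
  using assms by (cases x) (auto simp: exp_ereal_def)

lemma ln_ennreal_exp: "ln_ennreal (ennreal (exp x)) = ereal x"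
  by (simp add: ln_ennreal_def)

text \<open>A mixture giving weight a to a component loses at most \<open>- ln a / k\<close> against
  it. The extended form covers likelihoods 0 and \<open>\<infinity>\<close>.\<close>

lemma neg_ln_ennreal_antimono:
  assumes k: "0 < k" and a: "0 < a" and le: "ennreal a * x \<le> y"
  shows "ereal (- (1 / k)) * ln_ennreal y \<le> ereal (- (1 / k)) * ln_ennreal x + ereal (- ln a / k)"
proof (cases "x = 0 \<or> y = \<infinity>")
  case True
  then show ?thesis using k by (auto simp: ln_ennreal_def)
next
  case False
  then obtain y' where y: "y = ennreal y'" "0 \<le> y'" by (cases y rule: ennreal_cases) auto
  have "x \<noteq> \<infinity>" using le False a by (auto simp: ennreal_mult_top top_unique)
  then obtain x' where x: "x = ennreal x'" "0 \<le> x'" by (cases x rule: ennreal_cases) auto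
  have x': "0 < x'" using x False by (auto simp: less_le)
  have le': "a * x' \<le> y'" using le y x a by (simp flip: ennreal_mult)
  moreover have "0 < a * x'" using a x' by simp
  ultimately have y': "0 < y'" by linarith
  have "ln (a * x') \<le> ln y'" using le' \<open>0 < a * x'\<close> by (intro ln_mono) auto
  then have "ln a + ln x' \<le> ln y'" using a x' by (simp add: ln_mult)
  then have "(ln a + ln x') / k \<le> ln y' / k" using k by (intro divide_right_mono) auto
  then show ?thesis using x y x' y' by (simp add: ln_ennreal_def add_divide_distrib)
qed

text \<open>The setting at a single level: k stands for \<open>v \<epsilon>\<close>, and f' is the
  function that the convexity condition supplies for this \<epsilon>.\<close>

locale witnessed_ppc =
  fixes P :: "'z measure" and F :: "'f measure" and l :: "'f \<Rightarrow> 'z \<Rightarrow> ereal" and fs f' :: 'f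
    and u c \<epsilon> \<eta> k :: real
  assumes problem: "learning_problem P F l fs"
    and witness: "witness_condition P F l fs u c"
    and u: "0 < u" and c: "0 < c" and eta: "0 < \<eta>" "\<eta> < k"
    and f': "f' \<in> space F"
    and ppc: "ereal_expectation P (l f')
      - (INF Q\<in>space (prob_algebra F). ereal_expectation P (mix_loss l k Q)) \<le> ereal \<epsilon>"
begin

lemma k: "0 < k" using eta by simp

lemma prob_space_P: "prob_space P" using problem by (simp add: learning_problem_def)

sublocale P: prob_space P by (rule prob_space_P)

lemma measurable_loss[measurable]: "(\<lambda>(f, z). l f z) \<in> borel_measurable (F \<Otimes>\<^sub>M P)"
  and loss_not_MInf: "f \<in> space F \<Longrightarrow> z \<in> space P \<Longrightarrow> l f z \<noteq> -\<infinity>"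
  and fs: "fs \<in> space F"
  and optimal: "f \<in> space F \<Longrightarrow> 0 \<le> ereal_expectation P (excess_loss l fs f)"
  using problem by (simp_all add: learning_problem_def)

lemma measurable_loss1: "f \<in> space F \<Longrightarrow> l f \<in> borel_measurable P"
  using measurable_Pair2[OF measurable_loss, of f] by simp

lemma measurable_loss2: "z \<in> space P \<Longrightarrow> (\<lambda>f. l f z) \<in> borel_measurable F"
  using measurable_Pair1[OF measurable_loss, of z] by simp

text \<open>The quantity inside the logarithm of the mixture loss; being linear in Q, it is the form
  in which mixtures are computed.\<close>

definition likelihood :: "'f measure \<Rightarrow> 'z \<Rightarrow> ennreal" where
  "likelihood Q z = (\<integral>\<^sup>+ f. exp_ereal (ereal (- k) * l f z) \<partial>Q)"

lemma mix_loss_likelihood: "mix_loss l k Q z = ereal (- (1 / k)) * ln_ennreal (likelihood Q z)"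
  by (simp add: mix_loss_def likelihood_def)

lemma measurable_mix_loss:
  assumes Q: "Q \<in> space (prob_algebra F)"
  shows "mix_loss l k Q \<in> borel_measurable P"
proof -
  interpret Q: prob_space Q using Q by (simp add: space_prob_algebra)
  have [measurable_cong]: "sets Q = sets F" using Q by (simp add: space_prob_algebra)
  show ?thesis unfolding mix_loss_def by measurable
qed

lemma likelihood_return:
  assumes "f \<in> space F" "z \<in> space P"
  shows "likelihood (return F f) z = exp_ereal (ereal (- k) * l f z)"
proof -
  note [measurable] = measurable_loss2[OF assms(2)]
  show ?thesis unfolding likelihood_def by (subst nn_integral_return) (use assms in auto)
qed

lemma mix_loss_return:
  assumes "f \<in> space F" "z \<in> space P"
  shows "mix_loss l k (return F f) z = l f z"
  unfolding mix_loss_likelihood likelihood_return[OF assms] exp_ereal_times[OF k loss_not_MInf[OF assms]]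
  using loss_not_MInf[OF assms] k by (cases "l f z") (auto simp: ln_ennreal_def)

lemma expectation_mix_loss_return:
  "f \<in> space F \<Longrightarrow> ereal_expectation P (mix_loss l k (return F f)) = ereal_expectation P (l f)"
  by (intro ereal_expectation_cong_AE AE_I2 mix_loss_return)

lemma likelihood_mixture:
  assumes Q: "Q \<in> space (prob_algebra F)" "R \<in> space (prob_algebra F)" and t: "0 < t" "t < 1"
  obtains S where "S \<in> space (prob_algebra F)"
    "\<And>z. z \<in> space P \<Longrightarrow>
      likelihood S z = ennreal (1 - t) * likelihood Q z + ennreal t * likelihood R z"
proof -
  obtain S where S: "S \<in> space (prob_algebra F)"
    "\<And>h. h \<in> borel_measurable F \<Longrightarrow>
      (\<integral>\<^sup>+f. h f \<partial>S) = ennreal (1 - t) * (\<integral>\<^sup>+f. h f \<partial>Q) + ennreal t * (\<integral>\<^sup>+f. h f \<partial>R)"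
    using prob_algebra_mixture[OF assms] by blast
  have "likelihood S z = ennreal (1 - t) * likelihood Q z + ennreal t * likelihood R z"
    if z: "z \<in> space P" for z
  proof -
    note [measurable] = measurable_loss2[OF z]
    show ?thesis unfolding likelihood_def by (rule S(2)) measurable
  qed
  with S(1) show thesis by (rule that)
qed

section \<open>Finiteness of the infimum and integrability of single losses\<close>

definition lowest :: real where
  "lowest = real_of_ereal (INF Q\<in>space (prob_algebra F). ereal_expectation P (mix_loss l k Q))"

lemma lowest: "(INF Q\<in>space (prob_algebra F). ereal_expectation P (mix_loss l k Q)) = ereal lowest"
proof -
  let ?J = "INF Q\<in>space (prob_algebra F). ereal_expectation P (mix_loss l k Q)"
  obtain f0 where f0: "f0 \<in> space F" "ereal_expectation P (l f0) < \<infinity>"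
    using problem by (auto simp: learning_problem_def)
  have "?J \<le> ereal_expectation P (mix_loss l k (return F f0))"
    by (intro INF_lower return_in_prob_algebra f0)
  also have "\<dots> < \<infinity>" using f0 by (simp add: expectation_mix_loss_return)
  finally have "?J < \<infinity>" .
  \<comment> \<open>An infimum \<open>-\<infinity>\<close> would make the difference in
    \<open>ppc\<close> equal to \<open>\<infinity>\<close>, whatever the expected loss of f'
    is.\<close>
  moreover have "?J \<noteq> -\<infinity>" using ppc by auto
  ultimately show ?thesis unfolding lowest_def by (cases ?J) auto
qed

lemma lowest_le: "Q \<in> space (prob_algebra F) \<Longrightarrow> ereal lowest \<le> ereal_expectation P (mix_loss l k Q)"
  unfolding lowest[symmetric] by (rule INF_lower)

text \<open>Point masses compete in the infimum, so the expected loss of f' lies between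
  \<open>lowest\<close> and \<open>lowest + \<epsilon>\<close>.\<close>

lemma reference_integrable:
  "integrable P (\<lambda>z. real_of_ereal (l f' z))" "AE z in P. l f' z = ereal (real_of_ereal (l f' z))"
  "(\<integral>z. real_of_ereal (l f' z) \<partial>P) \<le> lowest + \<epsilon>"
proof -
  have le: "ereal_expectation P (l f') \<le> ereal (lowest + \<epsilon>)"
    using ppc unfolding lowest by (cases "ereal_expectation P (l f')") auto
  have ge: "ereal lowest \<le> ereal_expectation P (l f')"
    using lowest_le[OF return_in_prob_algebra[OF f']] by (simp add: expectation_mix_loss_return f')
  have fin: "-\<infinity> < ereal_expectation P (l f')" "ereal_expectation P (l f') < \<infinity>"
    using ge le by auto
  show i: "integrable P (\<lambda>z. real_of_ereal (l f' z))"
    and AE: "AE z in P. l f' z = ereal (real_of_ereal (l f' z))"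
    using integrable_ereal_expectation[OF measurable_loss1[OF f'] fin] by auto
  show "(\<integral>z. real_of_ereal (l f' z) \<partial>P) \<le> lowest + \<epsilon>"
    using ereal_expectation_integrable[OF i AE] le by simp
qed

text \<open>The minorant is the loss of the equal mixture of f' and f, lowered by
  \<open>ln 2 / k\<close>. That loss has expectation at least \<open>lowest\<close>, and at most
  \<open>ln 2 / k\<close> above that of f', hence is integrable.\<close>

lemma loss_ge_integrable:
  assumes f: "f \<in> space F"
  obtains g where "integrable P g" "AE z in P. ereal (g z) \<le> l f z"
proof -
  obtain S where S: "S \<in> space (prob_algebra F)"
    and eq: "\<And>z. z \<in> space P \<Longrightarrow> likelihood S z
      = ennreal (1 - 1 / 2) * likelihood (return F f') z + ennreal (1 / 2) * likelihood (return F f) z"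
    using likelihood_mixture[OF return_in_prob_algebra[OF f'] return_in_prob_algebra[OF f], of "1 / 2"]
    by auto
  have le: "mix_loss l k S z \<le> l h z + ereal (- ln (1 / 2) / k)"
    if z: "z \<in> space P" and h: "h = f' \<or> h = f" for z h
  proof -
    have "ennreal (1 / 2) * likelihood (return F h) z \<le> likelihood S z"
      using h by (auto simp: eq[OF z])
    from neg_ln_ennreal_antimono[OF k _ this] show ?thesis
      using mix_loss_return[of h z] h f f' z by (auto simp: mix_loss_likelihood)
  qed
  have "ereal_expectation P (mix_loss l k S)
      \<le> ereal_expectation P (\<lambda>z. l f' z + ereal (- ln (1 / 2) / k))"
    by (intro ereal_expectation_mono_AE AE_I2 le) auto
  also have "\<dots> = ereal (\<integral>z. real_of_ereal (l f' z) + (- ln (1 / 2) / k) \<partial>P)"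
  proof (rule ereal_expectation_integrable)
    show "AE z in P. l f' z + ereal (- ln (1 / 2) / k)
        = ereal (real_of_ereal (l f' z) + (- ln (1 / 2) / k))"
      using reference_integrable(2) by eventually_elim (metis plus_ereal.simps(1))
  qed (use reference_integrable in auto)
  finally have "ereal_expectation P (mix_loss l k S) < \<infinity>" by (auto intro: le_less_trans)
  moreover have "-\<infinity> < ereal_expectation P (mix_loss l k S)"
    using lowest_le[OF S] by (auto intro: less_le_trans)
  ultimately have i: "integrable P (\<lambda>z. real_of_ereal (mix_loss l k S z))"
    and AE: "AE z in P. mix_loss l k S z = ereal (real_of_ereal (mix_loss l k S z))"
    using integrable_ereal_expectation[OF measurable_mix_loss[OF S]] by auto
  show thesis
  proof
    show "integrable P (\<lambda>z. real_of_ereal (mix_loss l k S z) - (- ln (1 / 2) / k))"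
      using i by simp
    show "AE z in P. ereal (real_of_ereal (mix_loss l k S z) - (- ln (1 / 2) / k)) \<le> l f z"
      using AE AE_space
    proof eventually_elim
      case (elim z)
      define w where "w = - ln (1 / 2) / k"
      have "ereal (real_of_ereal (mix_loss l k S z)) \<le> l f z + ereal w"
        using le[of z f] elim by (simp add: w_def)
      then show ?case unfolding w_def[symmetric] by (cases "l f z") auto
    qed
  qed
qed

text \<open>Optimality speaks of excess losses, so integrability of \<open>l fs\<close> has to be
  derived. The excess loss of f' has nonnegative expectation and lies below \<open>l f' - g\<close>
  for an integrable minorant g of \<open>l fs\<close>; hence it is integrable, and so is
  \<open>l fs\<close> as a difference. Optimality also carries the bound by
  \<open>lowest + \<epsilon>\<close> over from f' to fs.\<close>

lemma optimal_loss_integrable: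
  "integrable P (\<lambda>z. real_of_ereal (l fs z))" "AE z in P. l fs z = ereal (real_of_ereal (l fs z))"
  "(\<integral>z. real_of_ereal (l fs z) \<partial>P) \<le> lowest + \<epsilon>"
proof -
  obtain g where g: "integrable P g" "AE z in P. ereal (g z) \<le> l fs z"
    using loss_ge_integrable[OF fs] by blast
  note [measurable] = measurable_loss1[OF fs] measurable_loss1[OF f']
  have m: "excess_loss l fs f' \<in> borel_measurable P" unfolding excess_loss_def[abs_def] by measurable
  have "ereal_expectation P (excess_loss l fs f')
      \<le> ereal_expectation P (\<lambda>z. ereal (real_of_ereal (l f' z) - g z))"
  proof (rule ereal_expectation_mono_AE)
    show "AE z in P. excess_loss l fs f' z \<le> ereal (real_of_ereal (l f' z) - g z)"
      using g(2) reference_integrable(2)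
    proof eventually_elim
      case (elim z)
      then have "excess_loss l fs f' z = ereal (real_of_ereal (l f' z)) - l fs z"
        by (simp add: excess_loss_def)
      then show ?case using elim(1) by (cases "l fs z") auto
    qed
  qed
  also have "\<dots> = ereal (\<integral>z. real_of_ereal (l f' z) - g z \<partial>P)"
    using g reference_integrable by (intro ereal_expectation_integrable) auto
  finally have "ereal_expectation P (excess_loss l fs f') < \<infinity>" by (auto intro: le_less_trans)
  moreover have "-\<infinity> < ereal_expectation P (excess_loss l fs f')"
    using optimal[OF f'] by (auto intro: less_le_trans)
  ultimately have i: "integrable P (\<lambda>z. real_of_ereal (excess_loss l fs f' z))"
    and AE: "AE z in P. excess_loss l fs f' z = ereal (real_of_ereal (excess_loss l fs f' z))"
    using integrable_ereal_expectation[OF m] by auto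
  have eq: "AE z in P. l fs z = ereal (real_of_ereal (l f' z) - real_of_ereal (excess_loss l fs f' z))"
    using AE reference_integrable(2)
  proof eventually_elim
    case (elim z)
    define p where "p = real_of_ereal (l f' z)"
    have "excess_loss l fs f' z = ereal p - l fs z" using elim p_def by (simp add: excess_loss_def)
    then show ?case using elim(1) unfolding p_def[symmetric] by (cases "l fs z") auto
  qed
  then have eq': "AE z in P. real_of_ereal (l f' z) - real_of_ereal (excess_loss l fs f' z) = real_of_ereal (l fs z)"
    by eventually_elim simp
  have d: "integrable P (\<lambda>z. real_of_ereal (l f' z) - real_of_ereal (excess_loss l fs f' z))"
    using i reference_integrable by simp
  show "integrable P (\<lambda>z. real_of_ereal (l fs z))"
    using integrable_cong_AE_imp[OF d _ eq'] by simp
  show "AE z in P. l fs z = ereal (real_of_ereal (l fs z))"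
    using eq by eventually_elim simp
  have "(\<integral>z. real_of_ereal (l fs z) \<partial>P)
      = (\<integral>z. real_of_ereal (l f' z) - real_of_ereal (excess_loss l fs f' z) \<partial>P)"
    by (rule integral_cong_AE[OF _ borel_measurable_integrable[OF d]])
      (use eq' in \<open>auto elim: eventually_mono\<close>)
  also have "\<dots> = (\<integral>z. real_of_ereal (l f' z) \<partial>P) - (\<integral>z. real_of_ereal (excess_loss l fs f' z) \<partial>P)"
    using i reference_integrable by simp
  also have "\<dots> \<le> (\<integral>z. real_of_ereal (l f' z) \<partial>P)"
    using ereal_expectation_integrable[OF i AE] optimal[OF f'] by simp
  finally show "(\<integral>z. real_of_ereal (l fs z) \<partial>P) \<le> lowest + \<epsilon>"
    using reference_integrable(3) by linarith
qed

subsection \<open>Risk bound by the Hellinger excess\<close>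

definition loss :: "'f \<Rightarrow> 'z \<Rightarrow> real" where "loss f z = real_of_ereal (l f z)"

lemma measurable_excess_loss: "f \<in> space F \<Longrightarrow> excess_loss l fs f \<in> borel_measurable P"
  using measurable_loss1[OF fs] measurable_loss1[of f] unfolding excess_loss_def[abs_def] by simp

lemma witness_expectation_le:
  "ereal_expectation P (\<lambda>z. excess_loss l fs f z * indicator {z. excess_loss l fs f z \<le> ereal u} z) \<le> ereal u"
proof -
  have "ereal_expectation P (\<lambda>z. excess_loss l fs f z * indicator {z. excess_loss l fs f z \<le> ereal u} z)
      \<le> ereal_expectation P (\<lambda>z. ereal u)"
    using u by (intro ereal_expectation_mono_AE) (auto simp: indicator_def zero_ereal_def[symmetric])
  also have "\<dots> = ereal (\<integral>z. u \<partial>P)" by (intro ereal_expectation_integrable) auto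
  finally show ?thesis by (simp add: P.prob_space)
qed

text \<open>The truncated excess is at most u, so the witness condition bounds c times the expected
  excess by u; optimality bounds the expectation below by 0.\<close>

lemma excess_loss_integrable:
  assumes f: "f \<in> space F"
  shows "integrable P (\<lambda>z. real_of_ereal (excess_loss l fs f z))"
    "AE z in P. excess_loss l fs f z = ereal (real_of_ereal (excess_loss l fs f z))"
proof -
  have "ereal c * ereal_expectation P (excess_loss l fs f)
    \<le> ereal_expectation P (\<lambda>z. excess_loss l fs f z * indicator {z. excess_loss l fs f z \<le> ereal u} z)"
    using witness f by (simp add: witness_condition_def)
  also note witness_expectation_le
  finally have "ereal_expectation P (excess_loss l fs f) \<noteq> \<infinity>"
    using c by (cases "ereal_expectation P (excess_loss l fs f)") auto
  moreover have "-\<infinity> < ereal_expectation P (excess_loss l fs f)"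
    using optimal[OF f] by (auto intro: less_le_trans)
  ultimately show "integrable P (\<lambda>z. real_of_ereal (excess_loss l fs f z))"
    "AE z in P. excess_loss l fs f z = ereal (real_of_ereal (excess_loss l fs f z))"
    using integrable_ereal_expectation[OF measurable_excess_loss[OF f]] by auto
qed

lemma loss_integrable:
  assumes f: "f \<in> space F"
  shows loss_AE: "AE z in P. l f z = ereal (loss f z)"
    and integrable_loss: "integrable P (loss f)"
proof -
  show AE: "AE z in P. l f z = ereal (loss f z)"
    using excess_loss_integrable(2)[OF f] optimal_loss_integrable(2)
  proof eventually_elim
    case (elim z)
    define p where "p = real_of_ereal (l fs z)"
    have "excess_loss l fs f z = l f z - ereal p" using elim p_def by (simp add: excess_loss_def)
    then show ?case using elim(1) by (cases "l f z") (auto simp: loss_def)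
  qed
  have "AE z in P. real_of_ereal (excess_loss l fs f z) + real_of_ereal (l fs z) = loss f z"
    using AE optimal_loss_integrable(2)
  proof eventually_elim
    case (elim z)
    have "excess_loss l fs f z = ereal (loss f z - real_of_ereal (l fs z))"
      unfolding excess_loss_def using elim by (metis ereal_minus(1))
    then show ?case by simp
  qed
  moreover have "loss f \<in> borel_measurable P"
    using measurable_loss1[OF f] unfolding loss_def[abs_def] by measurable
  ultimately show "integrable P (loss f)"
    using integrable_cong_AE_imp excess_loss_integrable(1)[OF f] optimal_loss_integrable(1)
      Bochner_Integration.integrable_add by blast
qed

lemma excess_loss_AE:
  assumes f: "f \<in> space F"
  shows "AE z in P. excess_loss l fs f z = ereal (loss f z - loss fs z)"
  using loss_AE[OF f] loss_AE[OF fs]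
  by eventually_elim (simp add: excess_loss_def)

lemma expectation_excess_loss:
  assumes f: "f \<in> space F"
  shows "ereal_expectation P (excess_loss l fs f) = ereal (\<integral>z. loss f z - loss fs z \<partial>P)"
  using integrable_loss f fs excess_loss_AE[OF f] by (intro ereal_expectation_integrable) auto

lemma truncated_integrable:
  assumes f: "f \<in> space F"
  shows "integrable P (\<lambda>z. (loss f z - loss fs z) * indicator {..u} (loss f z - loss fs z))"
proof (rule Bochner_Integration.integrable_bound)
  note [measurable] = borel_measurable_integrable[OF integrable_loss[OF f]]
    borel_measurable_integrable[OF integrable_loss[OF fs]]
  show "integrable P (\<lambda>z. loss f z - loss fs z)" using integrable_loss f fs by simp
  show "(\<lambda>z. (loss f z - loss fs z) * indicator {..u} (loss f z - loss fs z)) \<in> borel_measurable P"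
    by measurable
qed (auto simp: indicator_def)

lemma witness_real:
  assumes f: "f \<in> space F"
  shows "c * (\<integral>z. loss f z - loss fs z \<partial>P)
    \<le> (\<integral>z. (loss f z - loss fs z) * indicator {..u} (loss f z - loss fs z) \<partial>P)"
proof -
  have "ereal_expectation P (\<lambda>z. excess_loss l fs f z * indicator {z. excess_loss l fs f z \<le> ereal u} z)
      = ereal (\<integral>z. (loss f z - loss fs z) * indicator {..u} (loss f z - loss fs z) \<partial>P)"
  proof (rule ereal_expectation_integrable[OF truncated_integrable[OF f]])
    show "AE z in P. excess_loss l fs f z * indicator {z. excess_loss l fs f z \<le> ereal u} z
        = ereal ((loss f z - loss fs z) * indicator {..u} (loss f z - loss fs z))"
      using excess_loss_AE[OF f] by eventually_elim (auto simp: indicator_def)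
  qed
  moreover have "ereal c * ereal_expectation P (excess_loss l fs f)
    \<le> ereal_expectation P (\<lambda>z. excess_loss l fs f z * indicator {z. excess_loss l fs f z \<le> ereal u} z)"
    using witness f by (simp add: witness_condition_def)
  ultimately show ?thesis by (simp add: expectation_excess_loss[OF f])
qed

text \<open>Integrable mixture losses multiplied by k, so that the likelihood is
  \<open>exp (- g z)\<close> and the abstract projection theorem applies without a scale.\<close>

definition mix_losses :: "('z \<Rightarrow> real) set" where
  "mix_losses = {g. integrable P g \<and>
     (\<exists>Q\<in>space (prob_algebra F). AE z in P. likelihood Q z = ennreal (exp (- g z)))}"

lemma loss_in_mix_losses:
  assumes f: "f \<in> space F"
  shows "(\<lambda>z. k * loss f z) \<in> mix_losses"
  unfolding mix_losses_def
proof (intro CollectI conjI bexI)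
  show "return F f \<in> space (prob_algebra F)" by (rule return_in_prob_algebra[OF f])
  show "AE z in P. likelihood (return F f) z = ennreal (exp (- (k * loss f z)))"
    using loss_AE[OF f] AE_space
  proof eventually_elim
    case (elim z)
    then have "likelihood (return F f) z = exp_ereal (ereal (- k) * ereal (loss f z))"
      using likelihood_return[OF f] by metis
    then show ?case using k by (simp add: exp_ereal_def)
  qed
qed (use integrable_loss[OF f] in simp)

text \<open>Likelihoods are linear in the distribution, so the mixture of the two distributions
  realizes the new function. It is integrable because its absolute value is at most
  \<open>\<bar>g z\<bar> + \<bar>h z\<bar>\<close>.\<close>

lemma mix_losses_closed:
  assumes g: "g \<in> mix_losses" and h: "h \<in> mix_losses" and t: "0 < t" "t < 1"
  shows "(\<lambda>z. - ln ((1 - t) * exp (- g z) + t * exp (- h z))) \<in> mix_losses"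
  unfolding mix_losses_def
proof (intro CollectI conjI)
  let ?m = "\<lambda>z. (1 - t) * exp (- g z) + t * exp (- h z)"
  have gi: "integrable P g" and hi: "integrable P h" using g h by (auto simp: mix_losses_def)
  note [measurable] = borel_measurable_integrable[OF gi] borel_measurable_integrable[OF hi]
  have m_pos: "0 < ?m z" for z using t by (intro add_pos_pos) auto
  show "integrable P (\<lambda>z. - ln (?m z))"
  proof (rule Bochner_Integration.integrable_bound)
    show "integrable P (\<lambda>z. \<bar>g z\<bar> + \<bar>h z\<bar>)" using gi hi by simp
    show "AE z in P. norm (- ln (?m z)) \<le> norm (\<bar>g z\<bar> + \<bar>h z\<bar>)"
    proof (intro AE_I2)
      fix z
      let ?a = "\<bar>g z\<bar> + \<bar>h z\<bar>"
      have "(1 - t) * exp (- ?a) + t * exp (- ?a) \<le> ?m z"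
        using t by (intro add_mono mult_left_mono) auto
      then have 1: "exp (- ?a) \<le> ?m z" by (simp add: algebra_simps)
      have "?m z \<le> (1 - t) * exp ?a + t * exp ?a"
        using t by (intro add_mono mult_left_mono) auto
      then have 2: "?m z \<le> exp ?a" by (simp add: algebra_simps)
      have "ln (exp (- ?a)) \<le> ln (?m z)" "ln (?m z) \<le> ln (exp ?a)"
        using 1 2 m_pos[of z] by (intro ln_mono; simp)+
      then show "norm (- ln (?m z)) \<le> norm ?a" by simp
    qed
  qed measurable
  obtain Q R where Q: "Q \<in> space (prob_algebra F)" "AE z in P. likelihood Q z = ennreal (exp (- g z))"
    and R: "R \<in> space (prob_algebra F)" "AE z in P. likelihood R z = ennreal (exp (- h z))"
    using g h by (auto simp: mix_losses_def)
  obtain S where S: "S \<in> space (prob_algebra F)"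
    "\<And>z. z \<in> space P \<Longrightarrow> likelihood S z = ennreal (1 - t) * likelihood Q z + ennreal t * likelihood R z"
    using likelihood_mixture[OF Q(1) R(1) t] by blast
  show "\<exists>S\<in>space (prob_algebra F). AE z in P. likelihood S z = ennreal (exp (- (- ln (?m z))))"
  proof (intro bexI[OF _ S(1)])
    show "AE z in P. likelihood S z = ennreal (exp (- (- ln (?m z))))"
      using Q(2) R(2) AE_space
    proof eventually_elim
      case (elim z)
      have "likelihood S z = ennreal (1 - t) * ennreal (exp (- g z)) + ennreal t * ennreal (exp (- h z))"
        using S(2)[OF elim(3)] elim by simp
      also have "\<dots> = ennreal (?m z)" using t by (simp flip: ennreal_mult ennreal_plus)
      finally show ?case using m_pos[of z] by simp
    qed
  qed
qed

lemma mix_losses_ge: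
  assumes g: "g \<in> mix_losses"
  shows "k * lowest \<le> (\<integral>z. g z \<partial>P)"
proof -
  obtain Q where gi: "integrable P g" and Q: "Q \<in> space (prob_algebra F)"
    and AE: "AE z in P. likelihood Q z = ennreal (exp (- g z))"
    using g by (auto simp: mix_losses_def)
  have "ereal_expectation P (mix_loss l k Q) = ereal (\<integral>z. g z / k \<partial>P)"
    using gi AE by (intro ereal_expectation_integrable)
      (auto elim!: eventually_mono simp: mix_loss_likelihood ln_ennreal_exp)
  then show ?thesis using lowest_le[OF Q] k by (simp add: field_simps)
qed

lemma projection_exists:
  "\<exists>m. integrable P m \<and> (\<integral>z. loss fs z - m z \<partial>P) \<le> \<epsilon> \<and>
    (\<forall>f\<in>space F. (\<integral>\<^sup>+z. exp (- k * (loss f z - m z)) \<partial>P) \<le> 1)"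
proof -
  have bdd: "bdd_below ((\<lambda>g. \<integral>z. g z \<partial>P) ` mix_losses)"
    using mix_losses_ge by (intro bdd_belowI2) auto
  have ne: "mix_losses \<noteq> {}" using loss_in_mix_losses[OF fs] by auto
  have int: "integrable P g" if "g \<in> mix_losses" for g using that by (simp add: mix_losses_def)
  obtain m where m: "integrable P m" "(\<integral>z. m z \<partial>P) = (INF g\<in>mix_losses. \<integral>z. g z \<partial>P)"
    "\<And>g. g \<in> mix_losses \<Longrightarrow> (\<integral>\<^sup>+z. exp (m z - g z) \<partial>P) \<le> 1"
    using P.reversed_information_projection[OF ne int mix_losses_closed bdd] by blast
  \<comment> \<open>Together with \<open>optimal_loss_integrable\<close>, this direction puts the
    expected loss of fs within \<epsilon> of that of the projection.\<close>
  have "k * lowest \<le> (\<integral>z. m z \<partial>P)"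
    unfolding m(2) using ne mix_losses_ge by (intro cINF_greatest) auto
  then have ge: "lowest \<le> (\<integral>z. m z / k \<partial>P)" using k by (simp add: field_simps)
  show ?thesis
  proof (intro exI[of _ "\<lambda>z. m z / k"] conjI ballI)
    show "integrable P (\<lambda>z. m z / k)" using m by simp
    show "(\<integral>z. loss fs z - m z / k \<partial>P) \<le> \<epsilon>"
      using m(1) integrable_loss[OF fs] ge optimal_loss_integrable(3)
      by (subst Bochner_Integration.integral_diff) (auto simp: loss_def[symmetric])
    show "(\<integral>\<^sup>+z. exp (- k * (loss f z - m z / k)) \<partial>P) \<le> 1" if "f \<in> space F" for f
    proof -
      have "- k * (loss f z - m z / k) = m z - k * loss f z" for z using k by (simp add: field_simps)
      then show ?thesis using m(3)[OF loss_in_mix_losses[OF that]] by simp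
    qed
  qed
qed

definition projection :: "'z \<Rightarrow> real" where
  "projection = (SOME m. integrable P m \<and> (\<integral>z. loss fs z - m z \<partial>P) \<le> \<epsilon> \<and>
    (\<forall>f\<in>space F. (\<integral>\<^sup>+z. exp (- k * (loss f z - m z)) \<partial>P) \<le> 1))"

lemma projection_integrable: "integrable P projection"
  and projection_close: "(\<integral>z. loss fs z - projection z \<partial>P) \<le> \<epsilon>"
  and projection_central: "f \<in> space F \<Longrightarrow> (\<integral>\<^sup>+z. exp (- k * (loss f z - projection z)) \<partial>P) \<le> 1"
  using someI_ex[OF projection_exists] unfolding projection_def by blast+

lemma measurable_projection[measurable]: "projection \<in> borel_measurable P"
  using projection_integrable by (rule borel_measurable_integrable)

lemma measurable_real_loss: "f \<in> space F \<Longrightarrow> loss f \<in> borel_measurable P"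
  using integrable_loss by (rule borel_measurable_integrable)

section \<open>Exponential moments and the Hellinger excess\<close>

lemma exp_k_integrable:
  assumes f: "f \<in> space F"
  shows "integrable P (\<lambda>z. exp (- k * (loss f z - projection z)))"
    "(\<integral>z. exp (- k * (loss f z - projection z)) \<partial>P) \<le> 1"
proof -
  note [measurable] = measurable_real_loss[OF f]
  show i: "integrable P (\<lambda>z. exp (- k * (loss f z - projection z)))"
    using projection_central[OF f] by (intro integrableI_nonneg) (auto intro: le_less_trans)
  have "ennreal (\<integral>z. exp (- k * (loss f z - projection z)) \<partial>P) \<le> ennreal 1"
    using projection_central[OF f] nn_integral_eq_integral[OF i] by simp
  then show "(\<integral>z. exp (- k * (loss f z - projection z)) \<partial>P) \<le> 1" by (subst (asm) ennreal_le_iff) auto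
qed

lemma exp_eta_integrable:
  assumes f: "f \<in> space F"
  shows "integrable P (\<lambda>z. exp (- \<eta> * (loss f z - projection z)))"
proof (rule Bochner_Integration.integrable_bound)
  note [measurable] = measurable_real_loss[OF f]
  show "integrable P (\<lambda>z. 1 + exp (- k * (loss f z - projection z)))" using exp_k_integrable[OF f] by simp
  show "(\<lambda>z. exp (- \<eta> * (loss f z - projection z))) \<in> borel_measurable P" by measurable
  show "AE z in P. norm (exp (- \<eta> * (loss f z - projection z))) \<le> norm (1 + exp (- k * (loss f z - projection z)))"
  proof (intro AE_I2)
    fix z
    define x where "x = loss f z - projection z"
    \<comment> \<open>For nonnegative x the value is at most 1; for negative x the larger exponent k
      dominates.\<close>
    have "exp (- \<eta> * x) \<le> 1 + exp (- k * x)"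
    proof (cases "0 \<le> x")
      case True
      then have "exp (- \<eta> * x) \<le> 1" using eta by simp
      then show ?thesis by (simp add: add_increasing2)
    next
      case False
      then have "- \<eta> * x \<le> - k * x" using eta by (simp add: mult_right_mono_neg)
      then have "exp (- \<eta> * x) \<le> exp (- k * x)" by (simp only: exp_le_cancel_iff)
      then show ?thesis by linarith
    qed
    then show "norm (exp (- \<eta> * (loss f z - projection z))) \<le> norm (1 + exp (- k * (loss f z - projection z)))"
      unfolding x_def by (simp add: abs_of_nonneg)
  qed
qed

text \<open>Measured against the projection rather than fs. It lies between 0 and
  \<open>1 / \<eta>\<close>, hence is integrable under every distribution on the model, and it
  determines the exponential moment at \<eta>.\<close>

definition hellinger_excess :: "'f \<Rightarrow> real" where
  "hellinger_excess f = (\<integral>z. hellinger \<eta> (loss f z - projection z) \<partial>P)"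

lemma hellinger_excess_eq: "f \<in> space F \<Longrightarrow> (\<integral>z. exp (- \<eta> * (loss f z - projection z)) \<partial>P) = 1 - \<eta> * hellinger_excess f"
  using exp_eta_integrable[of f] eta by (simp add: hellinger_excess_def hellinger_def P.prob_space)

lemma hellinger_excess_upper: "f \<in> space F \<Longrightarrow> hellinger_excess f \<le> 1 / \<eta>"
proof -
  assume f: "f \<in> space F"
  have "0 \<le> (\<integral>z. exp (- \<eta> * (loss f z - projection z)) \<partial>P)" by (intro integral_nonneg_AE) auto
  then have "\<eta> * hellinger_excess f \<le> 1" unfolding hellinger_excess_eq[OF f] by simp
  then show ?thesis using eta by (simp add: field_simps)
qed

text \<open>Expectations are taken in \<open>truncated_diff_le_hellinger\<close>, with x and y the
  losses of f and fs minus the projection; the witness condition removes the truncation.\<close>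

lemma expected_excess_le_hellinger_excess:
  assumes f: "f \<in> space F"
  shows "(\<integral>z. loss f z - loss fs z \<partial>P) \<le> 1 / c * ((\<eta> * u + 1) / (1 - \<eta> / k)) * hellinger_excess f"
proof -
  define C where "C = (\<eta> * u + 1) / (1 - \<eta> / k)"
  let ?X = "\<lambda>z. loss f z - projection z" and ?Y = "\<lambda>z. loss fs z - projection z"
  have "0 < \<eta> * u" "0 < \<eta> / k" "\<eta> / k < 1" using eta u by auto
  then have C: "1 \<le> C" unfolding C_def by (simp add: le_divide_eq)
  have int: "integrable P (\<lambda>z. hellinger \<eta> (?X z))" "integrable P (\<lambda>z. hellinger k (?X z))"
    "integrable P (\<lambda>z. hellinger k (?Y z))"
    unfolding hellinger_def using exp_eta_integrable[OF f] exp_k_integrable(1)[OF f] exp_k_integrable(1)[OF fs]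
    by auto
  have nonneg: "0 \<le> (\<integral>z. hellinger k (loss h z - projection z) \<partial>P)" if "h \<in> space F" for h
    unfolding hellinger_def using exp_k_integrable[OF that] k by (simp add: P.prob_space)
  have "c * (\<integral>z. loss f z - loss fs z \<partial>P)
      \<le> (\<integral>z. (loss f z - loss fs z) * indicator {..u} (loss f z - loss fs z) \<partial>P)"
    by (rule witness_real[OF f])
  also have "\<dots> \<le> (\<integral>z. C * (hellinger \<eta> (?X z) - hellinger k (?X z)) + hellinger k (?X z) - hellinger k (?Y z) \<partial>P)"
  proof (rule integral_mono[OF truncated_integrable[OF f]])
    show "integrable P (\<lambda>z. C * (hellinger \<eta> (?X z) - hellinger k (?X z)) + hellinger k (?X z) - hellinger k (?Y z))"
      using int by simp
    show "(loss f z - loss fs z) * indicator {..u} (loss f z - loss fs z)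
        \<le> C * (hellinger \<eta> (?X z) - hellinger k (?X z)) + hellinger k (?X z) - hellinger k (?Y z)" for z
      using truncated_diff_le_hellinger[OF eta less_imp_le[OF u], of "?X z" "?Y z"] by (simp add: C_def)
  qed
  also have "\<dots> = C * (hellinger_excess f - (\<integral>z. hellinger k (?X z) \<partial>P)) + (\<integral>z. hellinger k (?X z) \<partial>P) - (\<integral>z. hellinger k (?Y z) \<partial>P)"
    using int by (simp add: hellinger_excess_def)
  \<comment> \<open>The \<open>hellinger k\<close> terms have nonnegative expectation since the
    moment at k is at most 1. The one for f carries the factor \<open>1 - C \<le> 0\<close>, the one
    for fs a minus sign.\<close>
  also have "\<dots> \<le> C * hellinger_excess f"
    using nonneg[OF f] nonneg[OF fs] C mult_right_mono[OF C nonneg[OF f]] by (simp add: algebra_simps)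
  finally show ?thesis using c unfolding C_def[symmetric] by (simp add: field_simps)
qed

text \<open>The risk is nonnegative by optimality and at most a positive multiple of this
  quantity.\<close>

lemma hellinger_excess_nonneg:
  assumes f: "f \<in> space F"
  shows "0 \<le> hellinger_excess f"
proof -
  have "0 \<le> (\<integral>z. loss f z - loss fs z \<partial>P)"
    using optimal[OF f] by (simp add: expectation_excess_loss[OF f])
  also note expected_excess_le_hellinger_excess[OF f]
  finally have "0 \<le> 1 / c * ((\<eta> * u + 1) / (1 - \<eta> / k)) * hellinger_excess f" .
  moreover have "0 < 1 / c * ((\<eta> * u + 1) / (1 - \<eta> / k))"
    using c u eta by (auto intro!: mult_pos_pos divide_pos_pos add_pos_pos)
  ultimately show ?thesis by (simp only: zero_le_mult_iff) linarith
qed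

subsection \<open>PAC-Bayes bound\<close>

text \<open>The case distinction gives \<open>exp (- \<infinity>) = 0\<close>; \<^const>\<open>real_of_ereal\<close> would turn an infinite loss into \<open>0\<close>.\<close>

definition ratio :: "'f \<Rightarrow> 'z \<Rightarrow> ennreal" where
  "ratio f z = (if l f z = \<infinity> then 0 else ennreal (exp (- \<eta> * (loss f z - projection z))))"

lemma measurable_ratio: "(\<lambda>(f, z). ratio f z) \<in> borel_measurable (F \<Otimes>\<^sub>M P)"
  unfolding ratio_def loss_def by measurable

lemma measurable_ratio1: "f \<in> space F \<Longrightarrow> ratio f \<in> borel_measurable P"
  using measurable_Pair2[OF measurable_ratio, of f] by simp

lemma nn_integral_ratio:
  assumes f: "f \<in> space F"
  shows "(\<integral>\<^sup>+z. ratio f z \<partial>P) = ennreal (1 - \<eta> * hellinger_excess f)"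
proof -
  have "(\<integral>\<^sup>+z. ratio f z \<partial>P) = (\<integral>\<^sup>+z. ennreal (exp (- \<eta> * (loss f z - projection z))) \<partial>P)"
    using loss_AE[OF f] by (intro nn_integral_cong_AE) (auto elim!: eventually_mono simp: ratio_def)
  then show ?thesis
    using nn_integral_eq_integral[OF exp_eta_integrable[OF f]] hellinger_excess_eq[OF f] by simp
qed

lemma measurable_hellinger_excess[measurable]: "hellinger_excess \<in> borel_measurable F"
proof -
  \<comment> \<open>Joint measurability of \<open>ratio\<close> makes its integral measurable in f;
    the conversion to reals is exact since \<open>1 - \<eta> * hellinger_excess f\<close> is
    nonnegative.\<close>
  have "(\<lambda>f. (1 - enn2real (\<integral>\<^sup>+z. ratio f z \<partial>P)) / \<eta>) \<in> borel_measurable F"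
    using measurable_ratio by measurable
  moreover have "(1 - enn2real (\<integral>\<^sup>+z. ratio f z \<partial>P)) / \<eta> = hellinger_excess f" if "f \<in> space F" for f
    using nn_integral_ratio[OF that] hellinger_excess_upper[OF that] eta by (simp add: field_simps)
  ultimately show ?thesis by (simp cong: measurable_cong)
qed

lemma hellinger_excess_integrable:
  assumes Q: "Q \<in> space (prob_algebra F)"
  shows "integrable Q hellinger_excess"
proof -
  interpret Q: prob_space Q using Q by (simp add: space_prob_algebra)
  have sets[measurable_cong]: "sets Q = sets F" using Q by (simp add: space_prob_algebra)
  show ?thesis
  proof (rule Q.integrable_const_bound)
    show "AE f in Q. norm (hellinger_excess f) \<le> 1 / \<eta>"
      using hellinger_excess_nonneg hellinger_excess_upper sets_eq_imp_space_eq[OF sets] by (intro AE_I2) auto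
  qed measurable
qed

lemma integral_hellinger_excess_bounds:
  assumes Q: "Q \<in> space (prob_algebra F)"
  shows "0 \<le> (\<integral>f. hellinger_excess f \<partial>Q)" "(\<integral>f. hellinger_excess f \<partial>Q) \<le> 1 / \<eta>"
proof -
  interpret Q: prob_space Q using Q by (simp add: space_prob_algebra)
  have sp: "space Q = space F" using Q by (intro sets_eq_imp_space_eq) (simp add: space_prob_algebra)
  show "0 \<le> (\<integral>f. hellinger_excess f \<partial>Q)" using hellinger_excess_nonneg sp by (intro integral_nonneg_AE AE_I2) auto
  show "(\<integral>f. hellinger_excess f \<partial>Q) \<le> 1 / \<eta>"
    using hellinger_excess_upper sp by (intro Q.integral_le_const hellinger_excess_integrable Q AE_I2) auto
qed

text \<open>The prior average of the exponential weights of the sample, each multiplied by a factor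
  that offsets its expected decay.\<close>

definition moment :: "'f measure \<Rightarrow> nat \<Rightarrow> (nat \<Rightarrow> 'z) \<Rightarrow> ennreal" where
  "moment R n \<omega> = (\<integral>\<^sup>+f. ennreal (exp (n * \<eta> * hellinger_excess f)) * (\<Prod>i<n. ratio f (\<omega> i)) \<partial>R)"

lemma measurable_ratio_component:
  assumes "i < n"
  shows "(\<lambda>(f, \<omega>). ratio f (\<omega> i)) \<in> borel_measurable (F \<Otimes>\<^sub>M PiM {..<n} (\<lambda>_. P))"
proof -
  have "(\<lambda>(f, \<omega>). (f, \<omega> i)) \<in> F \<Otimes>\<^sub>M PiM {..<n} (\<lambda>_. P) \<rightarrow>\<^sub>M F \<Otimes>\<^sub>M P"
    unfolding case_prod_beta
    by (intro measurable_Pair measurable_fst measurable_compose[OF measurable_snd measurable_component_singleton])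
      (use assms in auto)
  from measurable_compose[OF this measurable_ratio] show ?thesis by (simp add: case_prod_beta)
qed

lemma measurable_tilted_likelihood:
  "(\<lambda>(f, \<omega>). ennreal (exp (real n * \<eta> * hellinger_excess f)) * (\<Prod>i<n. ratio f (\<omega> i)))
    \<in> borel_measurable (F \<Otimes>\<^sub>M PiM {..<n} (\<lambda>_. P))"
  unfolding case_prod_beta
  by (intro borel_measurable_times_ennreal borel_measurable_prod_ennreal
      measurable_ratio_component[unfolded case_prod_beta]) (auto)

text \<open>After Fubini, independence turns the product into
  \<open>(1 - \<eta> * hellinger_excess f) ^ n\<close>, which \<open>1 + t \<le> exp t\<close>
  bounds by the reciprocal of the offsetting factor, for each single f.\<close>

lemma moment:
  assumes R: "R \<in> space (prob_algebra F)"
  shows measurable_moment: "moment R n \<in> borel_measurable (PiM {..<n} (\<lambda>_. P))"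
    and nn_integral_moment_le: "(\<integral>\<^sup>+\<omega>. moment R n \<omega> \<partial>PiM {..<n} (\<lambda>_. P)) \<le> 1"
proof -
  let ?M = "PiM {..<n} (\<lambda>_. P)"
  interpret R: prob_space R using R by (simp add: space_prob_algebra)
  interpret M: prob_space ?M by (intro prob_space_PiM prob_space_P)
  interpret product_sigma_finite "\<lambda>_::nat. P" ..
  interpret pair_sigma_finite R ?M ..
  have sets[measurable_cong]: "sets R = sets F" using R by (simp add: space_prob_algebra)
  note sp = sets_eq_imp_space_eq[OF sets]
  have m: "(\<lambda>(f, \<omega>). ennreal (exp (real n * \<eta> * hellinger_excess f)) * (\<Prod>i<n. ratio f (\<omega> i)))
    \<in> borel_measurable (R \<Otimes>\<^sub>M ?M)"
    using measurable_tilted_likelihood[of n] sets by (simp cong: measurable_cong_sets)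
  show "moment R n \<in> borel_measurable ?M"
    unfolding moment_def[abs_def] using m by measurable
  have "(\<integral>\<^sup>+\<omega>. moment R n \<omega> \<partial>?M)
      = (\<integral>\<^sup>+f. \<integral>\<^sup>+\<omega>. ennreal (exp (real n * \<eta> * hellinger_excess f)) * (\<Prod>i<n. ratio f (\<omega> i)) \<partial>?M \<partial>R)"
    unfolding moment_def using Fubini'[OF m] by simp
  also have "\<dots> \<le> (\<integral>\<^sup>+f. 1 \<partial>R)"
  proof (rule nn_integral_mono)
    fix f assume "f \<in> space R"
    then have f: "f \<in> space F" using sp by simp
    have q: "0 \<le> 1 - \<eta> * hellinger_excess f" using hellinger_excess_upper[OF f] eta by (simp add: field_simps)
    have "(\<lambda>\<omega>. \<Prod>i<n. ratio f (\<omega> i)) \<in> borel_measurable ?M"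
      using measurable_ratio1[OF f] by measurable
    then have "(\<integral>\<^sup>+\<omega>. ennreal (exp (real n * \<eta> * hellinger_excess f)) * (\<Prod>i<n. ratio f (\<omega> i)) \<partial>?M)
        = ennreal (exp (real n * \<eta> * hellinger_excess f)) * (\<integral>\<^sup>+\<omega>. (\<Prod>i<n. ratio f (\<omega> i)) \<partial>?M)"
      by (rule nn_integral_cmult)
    also have "(\<integral>\<^sup>+\<omega>. (\<Prod>i<n. ratio f (\<omega> i)) \<partial>?M) = (\<Prod>i<n. \<integral>\<^sup>+z. ratio f z \<partial>P)"
      using measurable_ratio1[OF f] by (intro product_nn_integral_prod) auto
    also have "\<dots> = ennreal ((1 - \<eta> * hellinger_excess f) ^ n)"
      using q by (simp add: nn_integral_ratio[OF f] ennreal_power)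
    also have "\<dots> \<le> ennreal (exp (- \<eta> * hellinger_excess f) ^ n)"
      using q exp_ge_add_one_self[of "- \<eta> * hellinger_excess f"] by (intro ennreal_leI power_mono) auto
    finally have "(\<integral>\<^sup>+\<omega>. ennreal (exp (real n * \<eta> * hellinger_excess f)) * (\<Prod>i<n. ratio f (\<omega> i)) \<partial>?M)
      \<le> ennreal (exp (real n * \<eta> * hellinger_excess f)) * ennreal (exp (- \<eta> * hellinger_excess f) ^ n)"
      by (simp add: mult_left_mono)
    also have "\<dots> = ennreal 1"
      unfolding exp_of_nat_mult[symmetric] ennreal_mult'[OF exp_ge_zero, symmetric] exp_add[symmetric]
      by simp
    finally show "(\<integral>\<^sup>+\<omega>. ennreal (exp (real n * \<eta> * hellinger_excess f)) * (\<Prod>i<n. ratio f (\<omega> i)) \<partial>?M) \<le> 1"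
      by simp
  qed
  also have "\<dots> = 1" by (simp add: R.emeasure_space_1)
  finally show "(\<integral>\<^sup>+\<omega>. moment R n \<omega> \<partial>?M) \<le> 1" .
qed

text \<open>\<open>KL_variational\<close> with posterior Q and prior R, applied to the logarithm of
  the integrand of \<open>moment\<close> and divided by \<open>\<eta> * n\<close>. The sum of
  \<open>loss fs - projection\<close> appears because information complexity compares with fs, the
  moment with the projection.\<close>

lemma information_complexity_ge:
  assumes Q: "Q \<in> space (prob_algebra F)" and R: "R \<in> space (prob_algebra F)"
    and n: "1 \<le> n" and \<omega>: "\<And>i. i < n \<Longrightarrow> \<omega> i \<in> space P"
    and fin: "\<And>i. i < n \<Longrightarrow> l fs (\<omega> i) = ereal (loss fs (\<omega> i))"
    and moment: "moment R n \<omega> < \<infinity>"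
  shows "ereal ((\<integral>f. hellinger_excess f \<partial>Q) - (\<Sum>i<n. loss fs (\<omega> i) - projection (\<omega> i)) / n
      - (enn2real (moment R n \<omega>) - 1) / (\<eta> * n))
    \<le> ereal_expectation Q (\<lambda>f. ereal (1 / n) * (\<Sum>i<n. excess_loss l fs f (\<omega> i)))
      + KL Q R / ereal (\<eta> * n)"
    (is "ereal ?N \<le> ereal_expectation Q ?e + _")
proof (cases "KL Q R = \<infinity> \<or> ereal_expectation Q ?e = \<infinity>")
  case True
  \<comment> \<open>Either infinite summand makes the right side \<open>\<infinity>\<close>,
    whatever the other one is.\<close>
  have "KL Q R \<noteq> -\<infinity>" by (simp add: KL_def)
  then have "KL Q R / ereal (\<eta> * n) \<noteq> -\<infinity>"
    using eta n by (cases "KL Q R") auto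
  then show ?thesis using True eta n by (auto simp: divide_ereal_def)
next
  case False
  interpret Q: prob_space Q using Q by (simp add: space_prob_algebra)
  have sets[measurable_cong]: "sets Q = sets F" "sets R = sets F"
    using Q R by (auto simp: space_prob_algebra)
  note sp = sets_eq_imp_space_eq[OF sets(1)]
  have pQ: "prob_space Q" "prob_space R" using Q R by (auto simp: space_prob_algebra)
  have ac: "absolutely_continuous R Q" and ent: "integrable Q (entropy_density (exp 1) R Q)"
    and KL: "KL Q R = ereal (KL_divergence (exp 1) R Q)"
    using False by (auto simp: KL_def split: if_splits)
  have n0: "0 < real n" using n by simp
  have [measurable]: "(\<lambda>f. l f (\<omega> i)) \<in> borel_measurable F" if "i < n" for i
    using measurable_loss2[OF \<omega>[OF that]] .
  have [measurable]: "(\<lambda>f. loss f (\<omega> i)) \<in> borel_measurable F" if "i < n" for i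
    unfolding loss_def using that by measurable
  have [measurable]: "(\<lambda>f. ratio f (\<omega> i)) \<in> borel_measurable F" if "i < n" for i
    unfolding ratio_def using that by measurable
  have e_meas: "?e \<in> borel_measurable F"
    unfolding excess_loss_def by measurable
  then have e_meas': "?e \<in> borel_measurable Q" by simp
  have pos: "(\<integral>\<^sup>+f. e2ennreal (?e f) \<partial>Q) < \<infinity>"
    using False by (intro ereal_expectation_pos_finite) auto
  have "AE f in Q. e2ennreal (?e f) \<noteq> \<infinity>"
    using pos e_meas' by (intro nn_integral_PInf_AE; simp)
  \<comment> \<open>One infinite summand makes the empirical sum infinite, so a finite positive part
    gives almost every f under Q a finite loss on the whole sample. Real losses can be used from
    here on.\<close>
  then have AE: "AE f in Q. \<forall>i<n. l f (\<omega> i) = ereal (loss f (\<omega> i))"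
    using AE_space
  proof eventually_elim
    case (elim f)
    then have f: "f \<in> space F" using sp by simp
    have no: "l f (\<omega> i) \<noteq> -\<infinity>" if "i < n" for i using loss_not_MInf[OF f \<omega>[OF that]] .
    show ?case
    proof (rule ccontr)
      assume "\<not> (\<forall>i<n. l f (\<omega> i) = ereal (loss f (\<omega> i)))"
      then obtain j where j: "j < n" "l f (\<omega> j) = \<infinity>"
        using no unfolding loss_def by (metis ereal_real ereal_infinity_cases)
      have "excess_loss l fs f (\<omega> j) = \<infinity>" using j fin by (simp add: excess_loss_def)
      then have "(\<Sum>i<n. excess_loss l fs f (\<omega> i)) = \<infinity>"
        using j by (subst sum_Pinfty) auto
      then show False using elim(1) n0 by simp
    qed
  qed
  define er where "er f = (\<Sum>i<n. loss f (\<omega> i) - loss fs (\<omega> i)) / n" for f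
  \<comment> \<open>The part independent of f: \<open>n * er f + Y\<close> is the empirical loss of
    f relative to the projection.\<close>
  define Y where "Y = (\<Sum>i<n. loss fs (\<omega> i) - projection (\<omega> i))"
  define H where "H f = n * \<eta> * hellinger_excess f - \<eta> * (n * er f + Y)" for f
  have H_eq: "H f = n * \<eta> * hellinger_excess f - \<eta> * (\<Sum>i<n. loss f (\<omega> i) - projection (\<omega> i))" for f
    unfolding H_def er_def Y_def using n0 by (simp add: sum_subtractf)
  have er_meas: "er \<in> borel_measurable F" unfolding er_def[abs_def] by measurable
  then have H_meas: "H \<in> borel_measurable R" unfolding H_def[abs_def] by measurable
  have e_AE: "AE f in Q. ?e f = ereal (er f)"
    using AE
  proof eventually_elim
    case (elim f)
    have "(\<Sum>i<n. excess_loss l fs f (\<omega> i)) = (\<Sum>i<n. ereal (loss f (\<omega> i) - loss fs (\<omega> i)))"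
      using elim fin by (intro sum.cong) (auto simp: excess_loss_def)
    then show ?case by (simp add: er_def)
  qed
  let ?G = "\<lambda>f. ennreal (exp (n * \<eta> * hellinger_excess f)) * (\<Prod>i<n. ratio f (\<omega> i))"
  have G_meas: "?G \<in> borel_measurable R" by measurable
  have GH: "AE f in Q. ?G f = ennreal (exp (H f))"
    using AE
  proof eventually_elim
    case (elim f)
    have "(\<Prod>i<n. ratio f (\<omega> i)) = (\<Prod>i<n. ennreal (exp (- \<eta> * (loss f (\<omega> i) - projection (\<omega> i)))))"
      using elim by (intro prod.cong) (auto simp: ratio_def)
    also have "\<dots> = ennreal (exp (\<Sum>i<n. - \<eta> * (loss f (\<omega> i) - projection (\<omega> i))))"
      by (simp add: prod_ennreal exp_sum)
    finally have "?G f = ennreal (exp (n * \<eta> * hellinger_excess f) * exp (\<Sum>i<n. - \<eta> * (loss f (\<omega> i) - projection (\<omega> i))))"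
      by (simp only: ennreal_mult'[OF exp_ge_zero])
    then show ?case
      unfolding H_eq exp_add[symmetric] by (simp only: sum_distrib_left[symmetric]) simp
  qed
  note KLv = KL_variational[OF pQ(2,1) _ ac ent G_meas H_meas GH moment[unfolded moment_def]]
  have Hp: "integrable Q (\<lambda>f. max 0 (H f))" using KLv(1) sets by simp
  \<comment> \<open>The positive part is finite in this case; the negative part is dominated through
    the positive part of \<open>H\<close>, because the Hellinger excess is nonnegative.\<close>
  have er_int: "integrable Q er"
  proof -
    have "(\<integral>\<^sup>+f. e2ennreal (- ?e f) \<partial>Q) \<le> (\<integral>\<^sup>+f. ennreal ((max 0 (H f) / \<eta> + \<bar>Y\<bar>) / n) \<partial>Q)"
    proof (rule nn_integral_mono_AE)
      show "AE f in Q. e2ennreal (- ?e f) \<le> ennreal ((max 0 (H f) / \<eta> + \<bar>Y\<bar>) / n)"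
        using e_AE AE_space
      proof eventually_elim
        case (elim f)
        then have "0 \<le> n * \<eta> * hellinger_excess f" using hellinger_excess_nonneg sp eta by simp
        then have "\<eta> * (- (n * er f)) \<le> max 0 (H f) + \<eta> * \<bar>Y\<bar>"
          using mult_left_mono[OF abs_ge_self[of Y] less_imp_le[OF eta(1)]]
          unfolding H_def by (simp add: algebra_simps max_def)
        then have "- er f \<le> (max 0 (H f) / \<eta> + \<bar>Y\<bar>) / n"
          using eta n0 by (simp add: field_simps)
        then show ?case unfolding elim(1) by (simp add: ennreal_leI)
      qed
    qed
    also have "\<dots> < \<infinity>"
      using Hp integrableD(2)[of Q "\<lambda>f. (max 0 (H f) / \<eta> + \<bar>Y\<bar>) / n"] by (simp add: less_top)
    finally have "integrable Q (\<lambda>f. real_of_ereal (?e f))"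
      using integrable_real_of_ereal(1)[OF e_meas' pos] by simp
    moreover have "er \<in> borel_measurable Q" using er_meas by simp
    moreover have "AE f in Q. real_of_ereal (?e f) = er f"
      using e_AE by eventually_elim (simp only: real_of_ereal.simps)
    ultimately show ?thesis by (rule integrable_cong_AE_imp)
  qed
  have "integrable Q H"
    unfolding H_def using er_int hellinger_excess_integrable[OF Q] by simp
  from KLv(2)[OF _ this] have "(\<integral>f. H f \<partial>Q) \<le> KL_divergence (exp 1) R Q + enn2real (moment R n \<omega>) - 1"
    using sets by (simp add: moment_def)
  moreover have "(\<integral>f. H f \<partial>Q) = n * \<eta> * (\<integral>f. hellinger_excess f \<partial>Q) - \<eta> * (n * (\<integral>f. er f \<partial>Q) + Y)"
    unfolding H_def using er_int hellinger_excess_integrable[OF Q] by (simp add: Q.prob_space)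
  ultimately have "?N \<le> (\<integral>f. er f \<partial>Q) + KL_divergence (exp 1) R Q / (\<eta> * n)"
  proof -
    define p a e K T where "p = \<eta> * n" and "a = (\<integral>f. hellinger_excess f \<partial>Q)" and "e = (\<integral>f. er f \<partial>Q)"
      and "K = KL_divergence (exp 1) R Q" and "T = enn2real (moment R n \<omega>)"
    assume "(\<integral>f. H f \<partial>Q) \<le> KL_divergence (exp 1) R Q + enn2real (moment R n \<omega>) - 1"
      and "(\<integral>f. H f \<partial>Q) = n * \<eta> * (\<integral>f. hellinger_excess f \<partial>Q) - \<eta> * (n * (\<integral>f. er f \<partial>Q) + Y)"
    then have le: "p * a - p * e - \<eta> * Y - (K + T - 1) \<le> 0"
      unfolding p_def a_def e_def K_def T_def by (simp add: algebra_simps)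
    have p: "0 < p" using eta n0 by (simp add: p_def)
    have "Y / n = \<eta> * Y / p" using eta by (simp add: p_def)
    then have "a - Y / n - (T - 1) / p - (e + K / p) = (p * a - p * e - \<eta> * Y - (K + T - 1)) / p"
      using p by (simp add: diff_divide_distrib add_divide_distrib)
    also have "\<dots> \<le> 0" using le p by (simp add: divide_le_0_iff)
    finally show ?thesis unfolding Y_def[symmetric] p_def a_def e_def K_def T_def by simp
  qed
  then show ?thesis
    unfolding KL ereal_expectation_integrable[OF er_int e_AE] using eta n0 by simp
qed

text \<open>The information complexity need not be measurable in the sample, so its expectation is bounded
  below through a pointwise integrable minorant.\<close>

lemma expected_information_complexity_ge:
  fixes A :: "'z list \<Rightarrow> 'f measure"
  assumes A: "learning_algorithm P F l A" and n: "1 \<le> n"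
  obtains b where "0 \<le> b"
    and "sample_expectation P n
           (\<lambda>zs. ereal_expectation (A zs) (\<lambda>f. ereal_expectation P (excess_loss l fs f)))
         \<le> ereal (1 / c * ((\<eta> * u + 1) / (1 - \<eta> / k)) * b)"
    and "ereal b \<le> sample_expectation P n (information_complexity l fs A \<eta>) + ereal \<epsilon>"
proof
  let ?M = "PiM {..<n} (\<lambda>_. P)"
  interpret M: prob_space ?M by (intro prob_space_PiM prob_space_P)
  define Q where "Q \<omega> = A (map \<omega> [0..<n])" for \<omega>
  have Q_meas: "Q \<in> ?M \<rightarrow>\<^sub>M prob_algebra F"
    using A by (simp add: learning_algorithm_def Q_def[abs_def])
  have Q: "Q \<omega> \<in> space (prob_algebra F)" if "\<omega> \<in> space ?M" for \<omega>
    using measurable_space[OF Q_meas that] .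
  \<comment> \<open>The prior is reached through the kernel property at sample size 0, where the
    product space has the single point \<open>\<lambda>_. undefined\<close>.\<close>
  have "(\<lambda>\<omega>. A (map \<omega> [0..<0])) \<in> PiM {..<0::nat} (\<lambda>_. P) \<rightarrow>\<^sub>M prob_algebra F"
    using A unfolding learning_algorithm_def by blast
  from measurable_space[OF this, of "\<lambda>_. undefined"] have R: "A [] \<in> space (prob_algebra F)"
    by (simp add: space_PiM)
  define h where "h \<omega> = (\<integral>f. hellinger_excess f \<partial>Q \<omega>)" for \<omega>
  have h_meas: "h \<in> borel_measurable ?M"
    unfolding h_def[abs_def]
    by (rule measurable_compose[OF measurable_prob_algebraD[OF Q_meas] integral_measurable_subprob_algebra])
      (rule measurable_hellinger_excess)
  have h_bounds: "0 \<le> h \<omega>" "h \<omega> \<le> 1 / \<eta>" if "\<omega> \<in> space ?M" for \<omega>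
    unfolding h_def using integral_hellinger_excess_bounds[OF Q[OF that]] by auto
  have h_int: "integrable ?M h"
    using h_bounds by (intro M.integrable_const_bound[of _ "1 / \<eta>"] AE_I2 h_meas) auto
  \<comment> \<open>The mean posterior Hellinger excess links both sides: a multiple of it bounds
    the risk, and it is itself bounded by the expected information complexity plus
    \<epsilon>.\<close>
  let ?b = "\<integral>\<omega>. h \<omega> \<partial>?M"
  let ?K = "1 / c * ((\<eta> * u + 1) / (1 - \<eta> / k))"
  show "0 \<le> ?b" using h_bounds by (intro integral_nonneg_AE AE_I2) auto
  have "sample_expectation P n
         (\<lambda>zs. ereal_expectation (A zs) (\<lambda>f. ereal_expectation P (excess_loss l fs f)))
      \<le> ereal_expectation ?M (\<lambda>\<omega>. ereal (?K * h \<omega>))"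
    unfolding sample_expectation_def Q_def[symmetric]
  proof (rule ereal_expectation_mono_AE, rule AE_I2)
    fix \<omega> assume \<omega>: "\<omega> \<in> space ?M"
    have sp: "space (Q \<omega>) = space F"
      using Q[OF \<omega>] by (intro sets_eq_imp_space_eq) (simp add: space_prob_algebra)
    have "ereal_expectation (Q \<omega>) (\<lambda>f. ereal_expectation P (excess_loss l fs f))
        \<le> ereal_expectation (Q \<omega>) (\<lambda>f. ereal (?K * hellinger_excess f))"
      using expected_excess_le_hellinger_excess sp
      by (intro ereal_expectation_mono_AE AE_I2) (simp add: expectation_excess_loss)
    also have "\<dots> = ereal (\<integral>f. ?K * hellinger_excess f \<partial>Q \<omega>)"
      using hellinger_excess_integrable[OF Q[OF \<omega>]] by (intro ereal_expectation_integrable integrable_mult_right) auto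
    also have "\<dots> = ereal (?K * h \<omega>)" unfolding h_def by (subst integral_mult_right_zero) simp
    finally show "ereal_expectation (Q \<omega>) (\<lambda>f. ereal_expectation P (excess_loss l fs f)) \<le> ereal (?K * h \<omega>)" .
  qed
  also have "\<dots> = ereal (\<integral>\<omega>. ?K * h \<omega> \<partial>?M)"
    using h_int by (intro ereal_expectation_integrable integrable_mult_right) auto
  also have "\<dots> = ereal (?K * ?b)" by (subst integral_mult_right_zero) simp
  finally show "sample_expectation P n
         (\<lambda>zs. ereal_expectation (A zs) (\<lambda>f. ereal_expectation P (excess_loss l fs f)))
      \<le> ereal (?K * ?b)" .

  define Y where "Y z = loss fs z - projection z" for z
  define T where "T = moment (A []) n"
  have T_meas[measurable]: "T \<in> borel_measurable ?M"
    unfolding T_def by (rule measurable_moment[OF R])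
  have T_le: "(\<integral>\<^sup>+\<omega>. T \<omega> \<partial>?M) \<le> 1"
    unfolding T_def by (rule nn_integral_moment_le[OF R])
  \<comment> \<open>\<open>information_complexity_ge\<close> requires a finite moment, which almost
    every sample has.\<close>
  have T_fin: "AE \<omega> in ?M. T \<omega> \<noteq> \<infinity>"
    using T_le by (intro nn_integral_PInf_AE T_meas) (auto simp: top_unique)
  have T_nn: "(\<integral>\<^sup>+\<omega>. ennreal (enn2real (T \<omega>)) \<partial>?M) = (\<integral>\<^sup>+\<omega>. T \<omega> \<partial>?M)"
    using T_fin by (intro nn_integral_cong_AE) (auto elim!: eventually_mono simp: less_top)
  have T_int: "integrable ?M (\<lambda>\<omega>. enn2real (T \<omega>))"
    using T_le by (intro integrableI_nonneg) (auto simp: T_nn intro: le_less_trans)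
  have "ennreal (\<integral>\<omega>. enn2real (T \<omega>) \<partial>?M) \<le> ennreal 1"
    using T_le nn_integral_eq_integral[OF T_int] T_nn by simp
  then have T_int_le: "(\<integral>\<omega>. enn2real (T \<omega>) \<partial>?M) \<le> 1" by (subst (asm) ennreal_le_iff) auto
  have Y_int: "integrable P Y"
    unfolding Y_def using integrable_loss[OF fs] projection_integrable by simp
  have Y_comp: "integrable ?M (\<lambda>\<omega>. Y (\<omega> i))" "(\<integral>\<omega>. Y (\<omega> i) \<partial>?M) = (\<integral>z. Y z \<partial>P)" if "i < n" for i
  proof -
    have m: "(\<lambda>\<omega>. \<omega> i) \<in> ?M \<rightarrow>\<^sub>M P" using that by (intro measurable_component_singleton) auto
    have d: "distr ?M P (\<lambda>\<omega>. \<omega> i) = P"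
      using distr_PiM_component[of "{..<n}" "\<lambda>_. P" i] prob_space_P that by simp
    show "integrable ?M (\<lambda>\<omega>. Y (\<omega> i))"
      using integrable_distr[OF m, of Y] Y_int d by simp
    show "(\<integral>\<omega>. Y (\<omega> i) \<partial>?M) = (\<integral>z. Y z \<partial>P)"
      using integral_distr[OF m, of Y] borel_measurable_integrable[OF Y_int] d by simp
  qed
  define N where "N \<omega> = h \<omega> - (\<Sum>i<n. Y (\<omega> i)) / n - (enn2real (T \<omega>) - 1) / (\<eta> * n)" for \<omega>
  have sum_int: "integrable ?M (\<lambda>\<omega>. (\<Sum>i<n. Y (\<omega> i)) / n)"
    using Y_comp by (intro integrable_divide Bochner_Integration.integrable_sum) auto
  have rem_int: "integrable ?M (\<lambda>\<omega>. (enn2real (T \<omega>) - 1) / (\<eta> * n))"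
    using T_int by (intro integrable_divide Bochner_Integration.integrable_diff) auto
  have N_int: "integrable ?M N"
    unfolding N_def[abs_def] using h_int sum_int rem_int by (intro Bochner_Integration.integrable_diff)
  \<comment> \<open>Of the subtracted terms, the first has expectation at most \<epsilon> by
    \<open>projection_close\<close>, the second at most 0 because the moment has expectation at most
    1.\<close>
  have "(\<integral>\<omega>. N \<omega> \<partial>?M)
      = ?b - (\<Sum>i<n. \<integral>z. Y z \<partial>P) / n - ((\<integral>\<omega>. enn2real (T \<omega>) \<partial>?M) - 1) / (\<eta> * n)"
  proof -
    have "(\<integral>\<omega>. N \<omega> \<partial>?M) = ?b - (\<integral>\<omega>. (\<Sum>i<n. Y (\<omega> i)) / n \<partial>?M)
        - (\<integral>\<omega>. (enn2real (T \<omega>) - 1) / (\<eta> * n) \<partial>?M)"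
      unfolding N_def using h_int sum_int rem_int
      by (subst Bochner_Integration.integral_diff; (intro Bochner_Integration.integrable_diff)?)+ auto
    moreover have "(\<integral>\<omega>. (\<Sum>i<n. Y (\<omega> i)) \<partial>?M) = (\<Sum>i<n. \<integral>z. Y z \<partial>P)"
      using Y_comp by (subst Bochner_Integration.integral_sum) auto
    moreover have "(\<integral>\<omega>. enn2real (T \<omega>) - 1 \<partial>?M) = (\<integral>\<omega>. enn2real (T \<omega>) \<partial>?M) - 1"
      using T_int by (subst Bochner_Integration.integral_diff) (auto simp: M.prob_space)
    ultimately show ?thesis by simp
  qed
  moreover have "(\<Sum>i<n. \<integral>z. Y z \<partial>P) / n \<le> \<epsilon>"
    using projection_close n by (simp add: Y_def)
  moreover have "((\<integral>\<omega>. enn2real (T \<omega>) \<partial>?M) - 1) / (\<eta> * n) \<le> 0"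
    using T_int_le eta n by (simp add: divide_le_0_iff)
  ultimately have N_ge: "?b - \<epsilon> \<le> (\<integral>\<omega>. N \<omega> \<partial>?M)" by linarith
  \<comment> \<open>The loss of fs must be finite at all sample points at once; the null sets of the
    finitely many coordinates are combined.\<close>
  have "AE \<omega> in ?M. l fs (\<omega> i) = ereal (loss fs (\<omega> i))" if "i \<in> {..<n}" for i
    using loss_AE[OF fs] that prob_space_P by (intro AE_PiM_component) auto
  then have "AE \<omega> in ?M. \<forall>i\<in>{..<n}. l fs (\<omega> i) = ereal (loss fs (\<omega> i))"
    by (intro AE_finite_allI) auto
  with T_fin AE_space have "AE \<omega> in ?M. ereal (N \<omega>) \<le> information_complexity l fs A \<eta> (map \<omega> [0..<n])"
  proof eventually_elim
    case (elim \<omega>)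
    have comp: "\<omega> i \<in> space P" if "i < n" for i
      using elim(2) that by (auto simp: space_PiM PiE_iff)
    have "(\<Sum>z\<leftarrow>map \<omega> [0..<n]. excess_loss l fs f z) = (\<Sum>i<n. excess_loss l fs f (\<omega> i))" for f
      by (simp add: comp_def interv_sum_list_conv_sum_set_nat atLeast0LessThan)
    then show ?case
      using information_complexity_ge[OF Q[OF elim(2)] R n comp] elim(1,3)
      unfolding information_complexity_def N_def h_def Y_def T_def Q_def
      by (simp add: less_top)
  qed
  then have "ereal_expectation ?M (\<lambda>\<omega>. ereal (N \<omega>))
      \<le> sample_expectation P n (information_complexity l fs A \<eta>)"
    unfolding sample_expectation_def by (rule ereal_expectation_mono_AE)
  then have "ereal (\<integral>\<omega>. N \<omega> \<partial>?M) \<le> sample_expectation P n (information_complexity l fs A \<eta>)"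
    using ereal_expectation_integrable[OF N_int] by simp
  then have "ereal (?b - \<epsilon>) \<le> sample_expectation P n (information_complexity l fs A \<eta>)"
    using N_ge by (meson ereal_less_eq(3) order_trans)
  then show "ereal ?b \<le> sample_expectation P n (information_complexity l fs A \<eta>) + ereal \<epsilon>"
    by (cases "sample_expectation P n (information_complexity l fs A \<eta>)") auto
qed

end

section \<open>Choice of the level \<open>v \<epsilon>\<close> and passage to the stated
  constant\<close>

theorem theorem29:
  fixes P :: "'z measure" and F :: "'f measure" and l :: "'f \<Rightarrow> 'z \<Rightarrow> ereal" and fs :: 'f
    and A :: "'z list \<Rightarrow> 'f measure"
    and u c \<epsilon> \<eta> :: real and v :: "real \<Rightarrow> real" and n :: nat
  assumes "learning_problem P F l fs"
    and "learning_algorithm P F l A"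
    and "0 < u" and "0 < c" and "c \<le> 1"
    and "witness_condition P F l fs u c"
    and "PPC_condition P F l v"
    and "0 \<le> \<epsilon>"
    and "0 < \<eta>" and "\<eta> < v \<epsilon> / 2"
    and "1 \<le> n"
  shows "sample_expectation P n
           (\<lambda>zs. ereal_expectation (A zs) (\<lambda>f. ereal_expectation P (excess_loss l fs f)))
         \<le> ereal (1 / c * ((2 * \<eta> * u + 1) / (1 - 2 * \<eta> / v \<epsilon>)))
           * (sample_expectation P n (information_complexity l fs A \<eta>) + ereal \<epsilon>)"
proof -
  have v: "0 < v \<epsilon>" "2 * \<eta> < v \<epsilon>" using assms by auto
  obtain f' where "f' \<in> space F" "ereal_expectation P (l f')
      - (INF Q\<in>space (prob_algebra F). ereal_expectation P (mix_loss l (v \<epsilon>) Q)) \<le> ereal \<epsilon>"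
    using assms v by (auto simp: PPC_condition_def)
  then interpret witnessed_ppc P F l fs f' u c \<epsilon> \<eta> "v \<epsilon>"
    using assms v by unfold_locales auto
  let ?C = "\<lambda>\<eta>. 1 / c * ((\<eta> * u + 1) / (1 - \<eta> / v \<epsilon>))"
  obtain b where b: "0 \<le> b"
    and loss: "sample_expectation P n
           (\<lambda>zs. ereal_expectation (A zs) (\<lambda>f. ereal_expectation P (excess_loss l fs f)))
         \<le> ereal (?C \<eta> * b)"
    and IC: "ereal b \<le> sample_expectation P n (information_complexity l fs A \<eta>) + ereal \<epsilon>"
    using expected_information_complexity_ge[OF assms(2,11)] by blast
  have q: "0 < 1 - 2 * \<eta> / v \<epsilon>" "1 - 2 * \<eta> / v \<epsilon> \<le> 1 - \<eta> / v \<epsilon>"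
    using v assms by (simp_all add: divide_right_mono)
  \<comment> \<open>Doubling \<eta> enlarges the numerator and shrinks the still positive
    denominator. As b \<ge> 0, the constant can be enlarged before b is replaced by the possibly
    infinite information complexity.\<close>
  have "?C \<eta> \<le> ?C (2 * \<eta>)"
    using q assms by (intro mult_left_mono frac_le) auto
  then have "?C \<eta> * b \<le> ?C (2 * \<eta>) * b" using b by (rule mult_right_mono)
  note loss
  also have "ereal (?C \<eta> * b) \<le> ereal (?C (2 * \<eta>)) * ereal b"
    using \<open>?C \<eta> * b \<le> ?C (2 * \<eta>) * b\<close> by simp
  also have "\<dots> \<le> ereal (?C (2 * \<eta>))
      * (sample_expectation P n (information_complexity l fs A \<eta>) + ereal \<epsilon>)"
    using q assms by (intro ereal_mult_left_mono IC) auto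
  finally show ?thesis by simp
qed

end
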